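(* Suppose that $n\geq 3k+3$ and $k\geq 1$. Let $\mathcal{L}$ be a Cameron-Liebler $k$-set of parameter $x$ in $\mathrm{PG}(n,q)$ such that $\mathcal{L}$ is not a point-pencil, nor the empty set. Then it holds that $$x\geq\frac{q^{n-k}-1}{q^{2k+2}-1}+1.$$
   Context: A Cameron-Liebler $k$-set in $\mathrm{PG}(n,q)$ ($n\geq 2k+1$) is a set $\mathcal{L}$ of $k$-spaces whose characteristic vector lies in the row space of the point-($k$-space) incidence matrix of $\mathrm{PG}(n,q)$; it has parameter $x$ if $|\mathcal{L}|=x\begin{bmatrix} n \\ k\end{bmatrix}_q$, where $\begin{bmatrix} b \\ a\end{bmatrix}_q=\frac{(q^b-1)\cdots(q^{b-a+1}-1)}{(q^a-1)\cdots(q-1)}$ is the Gaussian binomial coefficient. A point-pencil is the set of all $k$-spaces through a fixed point. *)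

theory Defs
  imports "HOL-Analysis.Analysis"
begin

text \<open>
  With \<open>'a\<close> a finite field of order \<open>q\<close> and \<open>CARD('n) = n + 1\<close>, the space \<open>PG(n,q)\<close> is modelled by
  the linear subspaces of \<open>'a ^ 'n\<close>. Dimensions are projective: a \<open>k\<close>-space is a linear subspace
  of vector space dimension \<open>k + 1\<close>, so a point is a \<open>0\<close>-space.
\<close>

definition kspaces :: "nat \<Rightarrow> ('a::field ^ 'n) set set" where
  "kspaces k = {U. vec.subspace U \<and> vec.dim U = k + 1}"

abbreviation points :: "('a::field ^ 'n) set set" where
  "points \<equiv> kspaces 0"

definition point_pencil :: "nat \<Rightarrow> ('a::field ^ 'n) set \<Rightarrow> ('a ^ 'n) set set" where
  "point_pencil k P = {U \<in> kspaces k. P \<subseteq> U}"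

text \<open>
  Rows and columns are indexed by all sets of vectors, because an index has to be a type. Rows not
  belonging to a point and columns not belonging to a \<open>k\<close>-space are zero; this padding only extends
  every vector of the row space by zero entries.
\<close>

definition incidence_matrix ::
  "nat \<Rightarrow> real ^ (('a::{field,finite} ^ 'n) set) ^ (('a ^ 'n) set)" where
  "incidence_matrix k =
     (\<chi> P U. if P \<in> points \<and> U \<in> kspaces k \<and> P \<subseteq> U then 1 else 0)"

definition characteristic_vector :: "'b::finite set \<Rightarrow> real ^ 'b" where
  "characteristic_vector L = (\<chi> U. if U \<in> L then 1 else 0)"

text \<open>The row space is taken over the real numbers.\<close>

definition cameron_liebler :: "nat \<Rightarrow> ('a::{field,finite} ^ 'n) set set \<Rightarrow> bool" where
  "cameron_liebler k L \<longleftrightarrow>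
     CARD('n) - 1 \<ge> 2 * k + 1 \<and> L \<subseteq> kspaces k \<and>
     characteristic_vector L \<in> span (rows (incidence_matrix k))"

text \<open>\<open>gaussian_binomial q b a\<close> is \<open>b\<close> over \<open>a\<close>, as for \<open>b choose a\<close>.\<close>

definition gaussian_binomial :: "nat \<Rightarrow> nat \<Rightarrow> nat \<Rightarrow> real" where
  "gaussian_binomial q b a =
     (\<Prod>i<a. real q ^ (b - i) - 1) / (\<Prod>i<a. real q ^ (a - i) - 1)"

definition has_parameter :: "nat \<Rightarrow> ('a::{field,finite} ^ 'n) set set \<Rightarrow> real \<Rightarrow> bool" where
  "has_parameter k L x \<longleftrightarrow>
     real (card L) = x * gaussian_binomial CARD('a) (CARD('n) - 1) k"

end

theory Submission
  imports Defs
begin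

text \<open>
  A vector in the row space of the incidence matrix is a weight on points, extended here to a function
  \<open>F\<close> on vectors such that the weight \<open>f U\<close> (the sum of \<open>F\<close> over \<open>U\<close>) of a \<open>k\<close>-space is \<open>1\<close> on \<open>L\<close> and \<open>0\<close>
  elsewhere; the parameter is the total weight \<open>x\<close>. Fix \<open>U\<close> in \<open>L\<close>. If every \<open>T\<close> of vector dimension
  \<open>3 k + 3\<close> through \<open>U\<close> has weight at least \<open>2\<close>, averaging the weight of \<open>T - U\<close> over the linear
  maps that fix \<open>U\<close> bounds the weight \<open>x - 1\<close> of the complement of \<open>U\<close> from below.

  Suppose instead that some such \<open>T\<close> has weight less than \<open>2\<close>. If \<open>V\<close> in \<open>L\<close> were a subspace of \<open>T\<close>
  disjoint from \<open>U\<close>, then averaging over graphs of isomorphisms from \<open>U\<close> to \<open>V\<close> and over \<open>k\<close>-spaces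
  of \<open>T\<close> disjoint from \<open>U + V\<close> would give \<open>T\<close> weight at least \<open>2\<close>. So all \<open>k\<close>-spaces of \<open>T\<close> disjoint
  from \<open>U\<close> have weight \<open>0\<close>, hence \<open>F\<close> vanishes on \<open>T - U\<close>, and on \<open>T\<close> it is the weight of a single
  point \<open>P\<close>. For \<open>v\<close> outside \<open>T\<close> and \<open>S\<close> of vector dimension \<open>k\<close> in \<open>T\<close>, the sum of \<open>F\<close> over \<open>v + S\<close>
  is nonpositive if \<open>P\<close> lies in \<open>S\<close> and nonnegative otherwise; comparing two partitions of \<open>v + Y\<close>
  into such cosets, for \<open>Y\<close> of vector dimension \<open>k + 1\<close>, shows that all these sums are \<open>0\<close>. Therefore \<open>F\<close>
  is the weight of \<open>P\<close> everywhere and \<open>L\<close> is a point-pencil.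
\<close>

section \<open>Subspaces over a finite field\<close>

lemma span_subspace:
  fixes X :: "('a::field ^ 'n) set"
  shows "vec.subspace X \<Longrightarrow> vec.span X = X"
  by (simp add: vec.span_eq_iff)

lemma span_subset_iff:
  fixes X :: "('a::field ^ 'n) set"
  shows "vec.subspace X \<Longrightarrow> vec.span S \<subseteq> X \<longleftrightarrow> S \<subseteq> X"
  using vec.span_minimal vec.span_superset by blast

lemma in_span_insert_subspace:
  fixes X :: "('a::field ^ 'n) set"
  assumes "vec.subspace X"
  shows "v \<in> vec.span (insert p X) \<longleftrightarrow> (\<exists>c. v - c *s p \<in> X)"
  using assms by (simp add: vec.span_insert span_subspace)

lemma dim_span_Un:
  fixes Z X :: "('a::field ^ 'n) set"
  assumes "vec.subspace Z" "vec.subspace X"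
  shows "vec.dim (vec.span (Z \<union> X)) + vec.dim (Z \<inter> X) = vec.dim Z + vec.dim X"
  using vec.dim_sums_Int[OF assms] assms by (simp add: vec.span_Un span_subspace)

lemma dim_span_Un_disjoint:
  fixes Z X :: "('a::field ^ 'n) set"
  assumes "vec.subspace Z" "vec.subspace X" "Z \<inter> X = {0}"
  shows "vec.dim (vec.span (Z \<union> X)) = vec.dim Z + vec.dim X"
  using dim_span_Un[OF assms(1,2)] assms(3) by simp

lemma dim_span_insert_subspace:
  fixes X :: "('a::field ^ 'n) set"
  assumes "vec.subspace X" "p \<notin> X"
  shows "vec.dim (vec.span (insert p X)) = Suc (vec.dim X)"
  using assms by (simp add: vec.dim_insert span_subspace)

text \<open>A vector \<open>x + c *s p\<close> of \<open>Z\<close> with \<open>x\<close> in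
  \<open>X\<close> and \<open>c \<noteq> 0\<close> would put \<open>p\<close> into
  \<open>Z + X\<close>, so only \<open>c = 0\<close> survives.\<close>

lemma span_insert_Int:
  fixes Z X :: "('a::field ^ 'n) set"
  assumes "vec.subspace Z" "vec.subspace X" "p \<notin> vec.span (Z \<union> X)"
  shows "vec.span (insert p X) \<inter> Z = X \<inter> Z"
proof -
  have "v \<in> X" if v: "v \<in> vec.span (insert p X)" "v \<in> Z" for v
  proof -
    obtain c where c: "v - c *s p \<in> X" using v in_span_insert_subspace[OF assms(2)] by blast
    have "v - (v - c *s p) \<in> vec.span (Z \<union> X)"
      using v(2) c by (intro vec.span_diff vec.span_base) auto
    then have cp: "c *s p \<in> vec.span (Z \<union> X)" by simp
    have "c = 0"
    proof (rule ccontr)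
      assume "c \<noteq> 0"
      then have "p = inverse c *s (c *s p)" by simp
      then show False using assms(3) cp vec.span_scale by metis
    qed
    then show "v \<in> X" using c by simp
  qed
  then show ?thesis by (auto intro: vec.span_base)
qed

text \<open>Vectors outside \<open>Z + X\<close> are adjoined one at a time. By
  \<open>span_insert_Int\<close> each leaves the intersection with \<open>Z\<close> alone, and it
  raises the dimension of \<open>Z + X\<close> by one, so the dimension bound allows
  \<open>j\<close> of them. Taking \<open>X = {0}\<close> gives subspaces disjoint from
  \<open>Z\<close>, and \<open>Z = {0}\<close> gives superspaces of prescribed dimension.\<close>

lemma extend_subspace_disjoint:
  fixes Z X T :: "('a::field ^ 'n) set"
  assumes "vec.subspace Z" "vec.subspace X" "vec.subspace T" "Z \<subseteq> T" "X \<subseteq> T"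
    and "vec.dim (vec.span (Z \<union> X)) + j \<le> vec.dim T"
  shows "\<exists>W. vec.subspace W \<and> X \<subseteq> W \<and> W \<subseteq> T \<and> W \<inter> Z = X \<inter> Z \<and> vec.dim W = vec.dim X + j"
  using assms(2,5,6)
proof (induction j arbitrary: X)
  case 0
  then show ?case by auto
next
  case (Suc j)
  have "\<not> T \<subseteq> vec.span (Z \<union> X)"
  proof
    assume "T \<subseteq> vec.span (Z \<union> X)"
    then have "vec.dim T \<le> vec.dim (vec.span (Z \<union> X))" by (rule vec.dim_subset)
    then show False using Suc.prems by simp
  qed
  then obtain p where p: "p \<in> T" "p \<notin> vec.span (Z \<union> X)" by blast
  let ?Y = "vec.span (insert p X)"
  have pX: "p \<notin> X" using p(2) by (auto intro: vec.span_base)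
  have YT: "?Y \<subseteq> T"
    using p(1) Suc.prems assms(3) by (intro vec.span_minimal) auto
  have "vec.span (Z \<union> ?Y) = vec.span (insert p (vec.span (Z \<union> X)))"
    by (intro vec.span_eq[THEN iffD2] conjI Un_least insert_subsetI vec.span_minimal
        vec.subspace_span subsetI)
      (auto intro: vec.span_base vec.span_mono[THEN subsetD, of "Z \<union> X"]
        vec.span_mono[THEN subsetD, of "insert p X"])
  then have "vec.dim (vec.span (Z \<union> ?Y)) = Suc (vec.dim (vec.span (Z \<union> X)))"
    using dim_span_insert_subspace[OF vec.subspace_span p(2)] by simp
  then have "\<exists>W. vec.subspace W \<and> ?Y \<subseteq> W \<and> W \<subseteq> T \<and> W \<inter> Z = ?Y \<inter> Z \<and> vec.dim W = vec.dim ?Y + j"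
    using Suc.prems(3) YT by (intro Suc.IH) auto
  then obtain W where W: "vec.subspace W" "?Y \<subseteq> W" "W \<subseteq> T" "W \<inter> Z = ?Y \<inter> Z" "vec.dim W = vec.dim ?Y + j"
    by blast
  have "vec.dim ?Y = Suc (vec.dim X)" "?Y \<inter> Z = X \<inter> Z" "X \<subseteq> ?Y"
    using dim_span_insert_subspace[OF Suc.prems(1) pX] span_insert_Int[OF assms(1) Suc.prems(1) p(2)]
    by (auto intro: vec.span_base)
  then have "vec.subspace W \<and> X \<subseteq> W \<and> W \<subseteq> T \<and> W \<inter> Z = X \<inter> Z \<and> vec.dim W = vec.dim X + Suc j"
    using W by auto
  then show ?case by blast
qed

lemma exists_disjoint_subspace:
  fixes Z T :: "('a::field ^ 'n) set"
  assumes "vec.subspace Z" "vec.subspace T" "Z \<subseteq> T" "vec.dim Z + j \<le> vec.dim T"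
  shows "\<exists>W. vec.subspace W \<and> W \<subseteq> T \<and> W \<inter> Z = {0} \<and> vec.dim W = j"
proof -
  have "vec.span (Z \<union> {0}) = Z"
    using assms(1) vec.subspace_0[OF assms(1)] by (simp add: Un_absorb2 span_subspace)
  then show ?thesis
    using extend_subspace_disjoint[of Z "{0}" T j] assms vec.subspace_0[OF assms(1)]
      vec.subspace_0[OF assms(2)] by auto
qed

lemma exists_superspace:
  fixes X T :: "('a::field ^ 'n) set"
  assumes "vec.subspace X" "vec.subspace T" "X \<subseteq> T" "vec.dim X \<le> m" "m \<le> vec.dim T"
  shows "\<exists>W. vec.subspace W \<and> X \<subseteq> W \<and> W \<subseteq> T \<and> vec.dim W = m"
proof -
  have "vec.span ({0} \<union> X) = X"
    using assms(1) vec.subspace_0[OF assms(1)] by (simp add: insert_absorb span_subspace)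
  then show ?thesis
    using extend_subspace_disjoint[of "{0}" X T "m - vec.dim X"] assms vec.subspace_0[OF assms(2)]
    by auto
qed

text \<open>The coset decomposition of \<open>X + \<langle>p\<rangle>\<close>, used both for
  counting vectors and for splitting sums.\<close>

lemma bij_betw_span_insert:
  fixes X :: "('a::field ^ 'n) set"
  assumes "vec.subspace X" "p \<notin> X"
  shows "bij_betw (\<lambda>(c, x). c *s p + x) (UNIV \<times> X) (vec.span (insert p X))"
proof -
  have inj: "c = d \<and> x = y" if "c *s p + x = d *s p + y" "x \<in> X" "y \<in> X" for c d x y
  proof -
    have "(c - d) *s p = y - x" using that(1) by (simp add: algebra_simps vec.scale_left_diff_distrib)
    then have cp: "(c - d) *s p \<in> X" using that assms(1) vec.subspace_diff by metis
    have "c - d = 0"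
    proof (rule ccontr)
      assume "c - d \<noteq> 0"
      then have "p = inverse (c - d) *s ((c - d) *s p)"
        by (simp only: vec.scale_scale left_inverse vec.scale_one not_False_eq_True)
      then show False using assms cp vec.subspace_scale by metis
    qed
    then show ?thesis using that(1) by simp
  qed
  have "(\<lambda>(c, x). c *s p + x) ` (UNIV \<times> X) = vec.span (insert p X)"
  proof (intro set_eqI iffI)
    fix v assume "v \<in> (\<lambda>(c, x). c *s p + x) ` (UNIV \<times> X)"
    then show "v \<in> vec.span (insert p X)"
      by (auto intro!: vec.span_add vec.span_scale intro: vec.span_base)
  next
    fix v assume "v \<in> vec.span (insert p X)"
    then obtain c where "v - c *s p \<in> X" by (auto simp: in_span_insert_subspace[OF assms(1)])
    then show "v \<in> (\<lambda>(c, x). c *s p + x) ` (UNIV \<times> X)"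
      by (intro image_eqI[of _ _ "(c, v - c *s p)"]) auto
  qed
  then show ?thesis by (auto simp: bij_betw_def inj_on_def dest!: inj)
qed

lemma card_span_independent:
  fixes B :: "('a::{field,finite} ^ 'n) set"
  assumes "finite B" "vec.independent B"
  shows "card (vec.span B) = CARD('a) ^ card B"
  using assms
proof (induction B rule: finite_induct)
  case empty
  then show ?case by simp
next
  case (insert b B)
  then have b: "b \<notin> vec.span B" "vec.independent B" by (auto simp: vec.independent_insert)
  have "vec.span (insert b B) = vec.span (insert b (vec.span B))"
    by (intro vec.span_eq[THEN iffD2] conjI insert_subsetI vec.span_minimal
        vec.subspace_span subsetI)
      (auto intro: vec.span_base vec.span_mono[THEN subsetD, of B])
  then show ?case
    using bij_betw_same_card[OF bij_betw_span_insert[OF vec.subspace_span b(1)]] insert b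
    by (simp add: card_cartesian_product)
qed

lemma card_subspace:
  fixes S :: "('a::{field,finite} ^ 'n) set"
  assumes "vec.subspace S"
  shows "card S = CARD('a) ^ vec.dim S"
proof -
  obtain B where B: "B \<subseteq> S" "vec.independent B" "S \<subseteq> vec.span B" "card B = vec.dim S"
    using vec.basis_exists by blast
  then have "vec.span B = S" using assms vec.span_minimal by blast
  then show ?thesis
    using card_span_independent[OF vec.finiteI_independent B(2)] B by simp
qed

lemma two_le_card_field: "2 \<le> CARD('a::{field,finite})"
proof -
  have "card {0, 1::'a} \<le> CARD('a)" by (rule card_mono) auto
  then show ?thesis by simp
qed

section \<open>Averaging over the linear maps that fix a flag\<close>

text \<open>The joint setwise stabiliser of \<open>Z\<close> and \<open>T\<close> in the general
  linear group of the whole space; in finite dimension, injectivity already gives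
  invertibility.\<close>

definition flag_maps :: "('a::field ^ 'n) set \<Rightarrow> ('a ^ 'n) set \<Rightarrow> ('a ^ 'n \<Rightarrow> 'a ^ 'n) set" where
  "flag_maps Z T = {g. Vector_Spaces.linear (*s) (*s) g \<and> inj g \<and> g ` Z = Z \<and> g ` T = T}"

lemma flag_maps_linear: "g \<in> flag_maps Z T \<Longrightarrow> Vector_Spaces.linear (*s) (*s) g"
  and flag_maps_inj: "g \<in> flag_maps Z T \<Longrightarrow> inj g"
  and flag_maps_image: "g \<in> flag_maps Z T \<Longrightarrow> g ` Z = Z" "g \<in> flag_maps Z T \<Longrightarrow> g ` T = T"
  by (auto simp: flag_maps_def)

lemma id_mem_flag_maps: "id \<in> flag_maps Z T"
  by (simp add: flag_maps_def vec.linear_id)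

lemma comp_mem_flag_maps:
  "g \<in> flag_maps Z T \<Longrightarrow> h \<in> flag_maps Z T \<Longrightarrow> g \<circ> h \<in> flag_maps Z T"
  by (auto simp only: flag_maps_def mem_Collect_eq image_comp[symmetric]
      intro: Vector_Spaces.linear_compose inj_compose)

lemma flag_maps_image_Diff:
  assumes "g \<in> flag_maps Z T"
  shows "g ` (T - Z) = T - Z"
  using assms by (simp add: flag_maps_def image_set_diff)

text \<open>The map \<open>x + N x\<close> sends \<open>v\<close> to \<open>w\<close>; it is injective because \<open>c \<noteq> 0\<close>.\<close>

lemma exists_direction_map:
  fixes Z :: "('a::field ^ 'n) set"
  assumes "vec.subspace Z" "v \<notin> Z" "w \<notin> Z"
  shows "\<exists>N c. Vector_Spaces.linear (*s) (*s) N \<and> c \<noteq> 0 \<and> (\<forall>z\<in>Z. N z = 0) \<and>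
           N v = w - v \<and> N w = c *s (w - v) \<and> range N \<subseteq> vec.span {w - v}"
proof -
  obtain B where B: "B \<subseteq> Z" "vec.independent B" "Z \<subseteq> vec.span B"
    by (rule vec.basis_exists[of Z])
  have spB: "vec.span B = Z" using B assms(1) vec.span_minimal by blast
  have ivB: "vec.independent (insert v B)" using B(2) assms(2) spB by (auto simp: vec.independent_insert)
  define f where "f = (\<lambda>x. if x \<in> B then 0 else w - v)"
  have fv: "f v = w - v" "f w = w - v" using assms B by (auto simp: f_def)
  have zero: "N z = 0" if N: "Vector_Spaces.linear (*s) (*s) N" "\<And>x. x \<in> B \<Longrightarrow> N x = f x" and "z \<in> Z"
    for N :: "'a ^ 'n \<Rightarrow> 'a ^ 'n" and z
    using vec.linear_eq_0_on_span[OF N(1), of B] N(2) that(3) spB by (auto simp: f_def)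
  have rng: "vec.span (f ` C) \<subseteq> vec.span {w - v}" for C
    by (intro vec.span_minimal vec.subspace_span)
      (auto simp: f_def intro: vec.span_base vec.span_zero)
  \<comment> \<open>If \<open>w\<close> lies in \<open>Z + \<langle>v\<rangle>\<close>, then
    \<open>N w\<close> is forced and \<open>c\<close> is the coefficient of \<open>v\<close> in
    \<open>w\<close>, nonzero because \<open>w \<notin> Z\<close>. Otherwise \<open>w\<close> is a
    further basis vector on which \<open>N\<close> can be chosen, and \<open>c = 1\<close> is
    taken.\<close>
  show ?thesis
  proof (cases "w \<in> vec.span (insert v B)")
    case True
    then obtain c where c: "w - c *s v \<in> Z" by (auto simp: vec.span_insert spB)
    obtain N where N: "Vector_Spaces.linear (*s) (*s) N" "\<forall>x\<in>insert v B. N x = f x"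
      "range N = vec.span (f ` insert v B)"
      using vec.linear_independent_extend_subspace[OF ivB, of f] by (elim exE conjE)
    have z: "\<forall>z\<in>Z. N z = 0" using zero[of N] N by blast
    have "c \<noteq> 0" using c assms by auto
    moreover have "N (w - c *s v) = N w - c *s N v"
      using N(1) by (simp add: vec.linear_diff vec.linear_scale)
    then have "N w = c *s (w - v)" using z c N fv by auto
    moreover have "N v = w - v" using N fv by auto
    moreover have "range N \<subseteq> vec.span {w - v}" by (simp only: N(3) rng)
    ultimately show ?thesis using N(1) z by (intro exI[of _ N] exI[of _ c]) simp
  next
    case False
    then have iB: "vec.independent (insert w (insert v B))" using ivB by (auto simp: vec.independent_insert)
    obtain N where N: "Vector_Spaces.linear (*s) (*s) N" "\<forall>x\<in>insert w (insert v B). N x = f x"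
      "range N = vec.span (f ` insert w (insert v B))"
      using vec.linear_independent_extend_subspace[OF iB, of f] by (elim exE conjE)
    have z: "\<forall>z\<in>Z. N z = 0" using zero[of N] N by blast
    moreover have "N v = w - v" "N w = w - v" using N fv by auto
    moreover have "range N \<subseteq> vec.span {w - v}" by (simp only: N(3) rng)
    ultimately show ?thesis using N(1) by (intro exI[of _ N] exI[of _ 1]) simp
  qed
qed

lemma linear_inj_image_subspace:
  fixes g :: "'a::field ^ 'n \<Rightarrow> 'a ^ 'n"
  assumes "Vector_Spaces.linear (*s) (*s) g" "inj g" "vec.subspace T" "g ` T \<subseteq> T"
  shows "g ` T = T"
proof (rule vec.subspace_dim_equal)
  show "vec.subspace (g ` T)" using assms vec.linear_subspace_image by blast
  show "vec.dim T \<le> vec.dim (g ` T)"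
    using vec.dim_image_eq[OF assms(1), of T] inj_on_subset[OF assms(2)] by simp
qed (use assms in auto)

text \<open>The map \<open>h\<close> built from \<open>exists_direction_map\<close> fixes
  \<open>Z\<close> pointwise and changes vectors only by multiples of \<open>w - v\<close>, which
  lies in \<open>T\<close>; hence it preserves both subspaces.\<close>

lemma flag_maps_transitive:
  fixes Z T :: "('a::field ^ 'n) set"
  assumes "vec.subspace Z" "vec.subspace T" "v \<in> T - Z" "w \<in> T - Z"
  shows "\<exists>h\<in>flag_maps Z T. h v = w"
proof -
  obtain N c where N: "Vector_Spaces.linear (*s) (*s) N" "c \<noteq> 0" "\<forall>z\<in>Z. N z = 0"
    "N v = w - v" "N w = c *s (w - v)" "range N \<subseteq> vec.span {w - v}"
    using exists_direction_map[OF assms(1), of v w] assms by auto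
  define h where "h = (\<lambda>x. x + N x)"
  have lin: "Vector_Spaces.linear (*s) (*s) h"
    unfolding h_def by (intro vec.linear_compose_add N(1) vec.linear_ident)
  \<comment> \<open>A vector killed by \<open>h\<close> is a multiple of \<open>w - v\<close>, and
    on these multiples \<open>h\<close> acts as the nonzero scalar \<open>c\<close>.\<close>
  have "d = 0" if "h d = 0" for d
  proof -
    obtain a where a: "N d = a *s (w - v)" using N(6) by (auto simp: vec.span_singleton)
    then have d: "d = (- a) *s (w - v)" using that
      by (simp only: h_def vec.scale_minus_left eq_neg_iff_add_eq_0)
    have "N d = (- a) *s (N w - N v)"
      using N(1) by (simp only: d vec.linear_diff vec.linear_scale)
    also have "\<dots> = (- a * (c - 1)) *s (w - v)"
      by (simp only: N(4,5)) (simp add: vec.scale_left_diff_distrib algebra_simps)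
    finally have "(- a * (c - 1) - a) *s (w - v) = 0"
      by (simp only: a vec.scale_left_diff_distrib diff_self)
    then have "a * c = 0 \<or> w = v" by (auto simp: algebra_simps)
    then show "d = 0" using d N(2) by auto
  qed
  then have inj: "inj h" using vec.linear_inj_iff_eq_0[OF lin] by simp
  have "h ` Z = Z" using N(3) by (auto simp: h_def)
  moreover have "h ` T = T"
  proof (rule linear_inj_image_subspace[OF lin inj assms(2)])
    have "vec.span {w - v} \<subseteq> T"
      using assms by (intro vec.span_minimal) (auto intro: vec.subspace_diff)
    then show "h ` T \<subseteq> T" using N(6) assms(2) by (auto simp: h_def intro!: vec.subspace_add)
  qed
  ultimately have "h \<in> flag_maps Z T" using lin inj by (simp add: flag_maps_def)
  moreover have "h v = w" using N(4) by (simp add: h_def)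
  ultimately show ?thesis by blast
qed

lemma card_flag_maps_pos:
  fixes Z T :: "('a::{field,finite} ^ 'n) set"
  shows "card (flag_maps Z T) > 0"
  using id_mem_flag_maps by (auto simp: card_gt_0_iff)

text \<open>For fixed \<open>v\<close> the images \<open>g v\<close> hit all vectors of
  \<open>T - Z\<close> equally often, so averaging over the group is averaging over
  \<open>T - Z\<close>. Both sides are multiplied out to avoid division.\<close>

lemma sum_flag_maps:
  fixes Z T :: "('a::{field,finite} ^ 'n) set" and F :: "'a ^ 'n \<Rightarrow> real"
  assumes "vec.subspace Z" "vec.subspace T" "v \<in> T - Z"
  shows "real (card (T - Z)) * (\<Sum>g\<in>flag_maps Z T. F (g v)) =
           real (card (flag_maps Z T)) * sum F (T - Z)"
proof -
  let ?G = "flag_maps Z T"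
  define S where "S = (\<lambda>w. {g \<in> ?G. g v = w})"
  define s where "s = card (S v)"
  have vT: "g v \<in> T - Z" if "g \<in> ?G" for g
    using flag_maps_image_Diff[OF that] assms(3) by blast
  \<comment> \<open>Composition with a map taking \<open>w\<close> to \<open>w'\<close> injects the
    fibre over \<open>w\<close> into the fibre over \<open>w'\<close>.\<close>
  have le: "card (S w) \<le> card (S w')" if w: "w \<in> T - Z" "w' \<in> T - Z" for w w'
  proof -
    obtain h where h: "h \<in> ?G" "h w = w'" using flag_maps_transitive[OF assms(1,2) w] by blast
    show ?thesis
    proof (rule card_inj_on_le[of "(\<circ>) h"])
      show "inj_on ((\<circ>) h) (S w)"
        using flag_maps_inj[OF h(1)] by (auto simp: inj_on_def fun_eq_iff)
      show "(\<circ>) h ` S w \<subseteq> S w'" using h comp_mem_flag_maps by (auto simp: S_def)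
    qed auto
  qed
  have cS: "card (S w) = s" if "w \<in> T - Z" for w
    unfolding s_def using le[OF that assms(3)] le[OF assms(3) that] by simp
  have img: "(\<lambda>g. g v) ` ?G \<subseteq> T - Z" using vT by auto
  have *: "(\<Sum>g\<in>?G. H (g v)) = real s * sum H (T - Z)" for H :: "'a ^ 'n \<Rightarrow> real"
  proof -
    have "(\<Sum>g\<in>?G. H (g v)) = (\<Sum>w\<in>T - Z. \<Sum>g\<in>{g \<in> ?G. g v = w}. H (g v))"
      by (rule sum.group[symmetric]) (use img in auto)
    also have "\<dots> = (\<Sum>w\<in>T - Z. real s * H w)"
      by (rule sum.cong) (auto simp: cS[unfolded S_def])
    finally show ?thesis by (simp add: sum_distrib_left)
  qed
  have "real (card ?G) = real s * real (card (T - Z))" using *[of "\<lambda>_. 1"] by simp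
  then show ?thesis using *[of F] by (simp only: mult_ac)
qed

text \<open>After summing the hypothesis over all \<open>g\<close> and exchanging sums, each
  \<open>v\<close> in \<open>A\<close> contributes the mean of \<open>F\<close> on
  \<open>T - Z\<close>. A bound valid for every image of \<open>A\<close> thus becomes a bound on
  this mean.\<close>

lemma orbit_average_ge:
  fixes Z T :: "('a::{field,finite} ^ 'n) set" and F :: "'a ^ 'n \<Rightarrow> real"
  assumes "vec.subspace Z" "vec.subspace T" "A \<subseteq> T - Z"
    and "\<And>g. g \<in> flag_maps Z T \<Longrightarrow> c \<le> sum F (g ` A)"
  shows "c * real (card (T - Z)) \<le> real (card A) * sum F (T - Z)"
proof -
  let ?G = "flag_maps Z T"
  have "real (card ?G) * (c * real (card (T - Z))) = (\<Sum>g\<in>?G. c) * real (card (T - Z))"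
    by simp
  also have "\<dots> \<le> (\<Sum>g\<in>?G. sum F (g ` A)) * real (card (T - Z))"
    using assms(4) by (intro mult_right_mono sum_mono) auto
  also have "(\<Sum>g\<in>?G. sum F (g ` A)) = (\<Sum>g\<in>?G. \<Sum>v\<in>A. F (g v))"
    by (intro sum.cong refl sum.reindex[unfolded o_def] inj_on_subset[OF flag_maps_inj]) auto
  also have "\<dots> = (\<Sum>v\<in>A. \<Sum>g\<in>?G. F (g v))" by (rule sum.swap)
  also have "\<dots> * real (card (T - Z)) = (\<Sum>v\<in>A. real (card (T - Z)) * (\<Sum>g\<in>?G. F (g v)))"
    by (simp add: sum_distrib_left mult.commute)
  also have "\<dots> = (\<Sum>v\<in>A. real (card ?G) * sum F (T - Z))"
    using assms(3) by (intro sum.cong refl sum_flag_maps[OF assms(1,2)]) auto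
  also have "\<dots> = real (card ?G) * (real (card A) * sum F (T - Z))" by simp
  finally show ?thesis using card_flag_maps_pos[of Z T] by (simp only: mult_le_cancel_left_pos of_nat_0_less_iff)
qed

lemma flag_maps_image_subspace:
  fixes V :: "('a::field ^ 'n) set"
  assumes "g \<in> flag_maps Z T" "vec.subspace V"
  shows "vec.subspace (g ` V)" "vec.dim (g ` V) = vec.dim V"
  using vec.linear_subspace_image[OF flag_maps_linear[OF assms(1)] assms(2)]
    vec.dim_image_eq[OF flag_maps_linear[OF assms(1)], of V]
    inj_on_subset[OF flag_maps_inj[OF assms(1)], of "vec.span V"]
  by auto

section \<open>Counting subspaces through a subspace\<close>

text \<open>Double counting of the pairs \<open>(U, p)\<close> with \<open>p \<in> U - Z\<close> reduces \<open>Z\<close> to \<open>Z + \<langle>p\<rangle>\<close>.\<close>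

lemma card_superspaces:
  fixes Z :: "('a::{field,finite} ^ 'n) set"
  assumes "vec.subspace Z" "vec.dim Z \<le> d"
  shows "real (card {U. vec.subspace U \<and> Z \<subseteq> U \<and> vec.dim U = d}) =
    (\<Prod>i = vec.dim Z..<d. (real CARD('a) ^ CARD('n) - real CARD('a) ^ i) /
       (real CARD('a) ^ d - real CARD('a) ^ i))"
  using assms
proof (induction "d - vec.dim Z" arbitrary: Z)
  case 0
  then have "{U. vec.subspace U \<and> Z \<subseteq> U \<and> vec.dim U = d} = {Z}"
    using vec.subspace_dim_equal[of Z] by (intro equalityI subsetI) force+
  then show ?case using 0 by simp
next
  case (Suc j)
  let ?q = "real CARD('a)"
  let ?S = "\<lambda>Z. {U. vec.subspace U \<and> Z \<subseteq> U \<and> vec.dim U = d}"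
  let ?f = "\<lambda>i. (?q ^ CARD('n) - ?q ^ i) / (?q ^ d - ?q ^ i)"
  have zd: "vec.dim Z < d" using Suc.hyps(2) by simp
  have q1: "?q > 1" using two_le_card_field[where 'a='a] by simp
  have card_diff: "real (card (U - Z)) = ?q ^ vec.dim U - ?q ^ vec.dim Z"
    if "vec.subspace U" "Z \<subseteq> U" for U :: "('a ^ 'n) set"
  proof -
    have "card (U - Z) = card U - card Z" "card Z \<le> card U"
      using that by (auto intro: card_Diff_subset card_mono)
    then show ?thesis using that Suc.prems(1) by (simp add: card_subspace of_nat_diff)
  qed
  have through: "real (card {U \<in> ?S Z. p \<in> U}) = (\<Prod>i = Suc (vec.dim Z)..<d. ?f i)" if p: "p \<in> - Z" for p
  proof -
    let ?Y = "vec.span (insert p Z)"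
    have Y: "vec.dim ?Y = Suc (vec.dim Z)" using dim_span_insert_subspace[OF Suc.prems(1)] p by simp
    have "{U \<in> ?S Z. p \<in> U} = ?S ?Y"
      by simp (metis insert_subset span_subset_iff)
    then show ?thesis using Suc.hyps(1)[of ?Y] Suc.hyps(2) Y zd by simp
  qed
  have "real (card (?S Z)) * (?q ^ d - ?q ^ vec.dim Z) = (\<Sum>U\<in>?S Z. real (card (U - Z)))"
    using card_diff by simp
  also have "\<dots> = (\<Sum>U\<in>?S Z. \<Sum>p\<in>- Z. if p \<in> U then 1 else 0)"
    by (intro sum.cong refl) (simp add: sum.If_cases Int_def Diff_eq conj_commute)
  also have "\<dots> = (\<Sum>p\<in>- Z. \<Sum>U\<in>?S Z. if p \<in> U then 1 else 0)" by (rule sum.swap)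
  also have "\<dots> = (\<Sum>p\<in>- Z. real (card {U \<in> ?S Z. p \<in> U}))"
    by (intro sum.cong refl) (simp add: sum.If_cases Int_def)
  also have "\<dots> = real (card (UNIV - Z)) * (\<Prod>i = Suc (vec.dim Z)..<d. ?f i)"
    using through by (simp add: Compl_eq_Diff_UNIV)
  also have "real (card (UNIV - Z)) = ?q ^ CARD('n) - ?q ^ vec.dim Z"
    using card_diff[of UNIV] vec_dim_card[where 'a='a and 'n='n] by simp
  finally have eq: "real (card (?S Z)) * (?q ^ d - ?q ^ vec.dim Z) =
      (?q ^ CARD('n) - ?q ^ vec.dim Z) * (\<Prod>i = Suc (vec.dim Z)..<d. ?f i)" .
  have "?q ^ d - ?q ^ vec.dim Z \<noteq> 0" using zd q1 by (simp add: power_inject_exp)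
  then have "real (card (?S Z)) = ?f (vec.dim Z) * (\<Prod>i = Suc (vec.dim Z)..<d. ?f i)"
    using eq by (simp add: field_simps)
  then show ?case using zd by (simp add: prod.atLeast_Suc_lessThan)
qed

text \<open>This is \<open>card_superspaces\<close> for \<open>\<langle>v\<rangle>\<close>: shift
  the index by the vector dimension \<open>1\<close> and cancel \<open>q ^ Suc i\<close> from each
  factor.\<close>

lemma card_kspaces_through:
  fixes v :: "'a::{field,finite} ^ 'n"
  assumes "v \<noteq> 0" "k \<le> CARD('n) - 1"
  shows "real (card {U \<in> kspaces k. v \<in> U}) = gaussian_binomial CARD('a) (CARD('n) - 1) k"
proof -
  let ?q = "real CARD('a)"
  define n where "n = CARD('n) - 1"
  have n: "CARD('n) = Suc n" by (simp add: n_def)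
  have q: "?q > 1" using two_le_card_field[where 'a='a] by simp
  have "{U \<in> kspaces k. v \<in> U} =
      {U. vec.subspace U \<and> vec.span {v} \<subseteq> U \<and> vec.dim U = k + 1}"
    by (simp add: kspaces_def) (metis empty_subsetI insert_subset span_subset_iff)
  then have "real (card {U \<in> kspaces k. v \<in> U}) =
     (\<Prod>i = 1..<k + 1. (?q ^ CARD('n) - ?q ^ i) / (?q ^ (k + 1) - ?q ^ i))"
    using card_superspaces[of "vec.span {v}" "k + 1"] assms(1) by simp
  also have "\<dots> = (\<Prod>i<k. (?q ^ CARD('n) - ?q ^ Suc i) / (?q ^ (k + 1) - ?q ^ Suc i))"
    by (simp add: prod.shift_bounds_Suc_ivl lessThan_atLeast0 del: prod.op_ivl_Suc power_Suc)
  also have "\<dots> = (\<Prod>i<k. (?q ^ (n - i) - 1) / (?q ^ (k - i) - 1))"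
  proof (rule prod.cong[OF refl])
    fix i assume i: "i \<in> {..<k}"
    have "?q ^ CARD('n) = ?q ^ Suc i * ?q ^ (n - i)" "?q ^ (k + 1) = ?q ^ Suc i * ?q ^ (k - i)"
      using i assms(2) n by (simp_all flip: power_add power_Suc)
    then have "?q ^ CARD('n) - ?q ^ Suc i = ?q ^ Suc i * (?q ^ (n - i) - 1)"
        "?q ^ (k + 1) - ?q ^ Suc i = ?q ^ Suc i * (?q ^ (k - i) - 1)"
      by (simp_all only: right_diff_distrib mult_1_right)
    then show "(?q ^ CARD('n) - ?q ^ Suc i) / (?q ^ (k + 1) - ?q ^ Suc i) =
        (?q ^ (n - i) - 1) / (?q ^ (k - i) - 1)"
      using q by simp
  qed
  finally show ?thesis by (simp add: gaussian_binomial_def prod_dividef n_def)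
qed

section \<open>Cameron-Liebler sets as weight functions\<close>

text \<open>Encodes a real weight on projective points as a function on vectors: the weight of a
  point is split evenly among its \<open>q - 1\<close> nonzero vectors, so \<open>sum F U\<close> is
  the total weight of the points in a subspace \<open>U\<close>.\<close>

definition point_weight :: "('a::field ^ 'n \<Rightarrow> real) \<Rightarrow> bool" where
  "point_weight F \<longleftrightarrow> F 0 = 0 \<and> (\<forall>c v. c \<noteq> 0 \<longrightarrow> F (c *s v) = F v)"

lemma dim_1_Int:
  fixes P U :: "('a::field ^ 'n) set"
  assumes "vec.subspace P" "vec.dim P = 1" "vec.subspace U" "\<not> P \<subseteq> U"
  shows "P \<inter> U = {0}"
proof -
  have s: "vec.subspace (P \<inter> U)" using assms vec.subspace_inter by blast
  have d: "vec.dim (P \<inter> U) = 0"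
  proof (rule ccontr)
    assume "vec.dim (P \<inter> U) \<noteq> 0"
    then have "P \<inter> U = P"
      using s assms(1,2) by (intro vec.subspace_dim_equal) (auto simp del: vec.dim_eq_0)
    then show False using assms(4) by blast
  qed
  show ?thesis
    using vec.subspace_dim_equal[OF vec.subspace_single_0 s] d vec.subspace_0[OF s] by auto
qed

text \<open>The row of the incidence matrix at \<open>P\<close>, seen as a weight: the
  \<open>q - 1\<close> nonzero vectors of \<open>P\<close> share the weight \<open>1\<close>, and
  \<open>U\<close> contains either all of them or none.\<close>

lemma point_weight_of_point:
  fixes P :: "('a::{field,finite} ^ 'n) set"
  assumes "P \<in> points"
  defines "F \<equiv> (\<lambda>v. if v \<in> P \<and> v \<noteq> 0 then 1 / (real CARD('a) - 1) else 0)"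
  shows "point_weight F"
    and "vec.subspace U \<Longrightarrow> sum F U = (if P \<subseteq> U then 1 else 0)"
proof -
  have P: "vec.subspace P" "vec.dim P = 1" using assms by (auto simp: kspaces_def)
  have "c *s v \<in> P \<longleftrightarrow> v \<in> P" if "c \<noteq> 0" for c v
    using that P(1) by (metis vec.scale_scale left_inverse vec.scale_one vec.subspace_scale)
  then show "point_weight F" by (auto simp: point_weight_def F_def)
  have q: "real CARD('a) > 1" using two_le_card_field[where 'a='a] by simp
  show "sum F U = (if P \<subseteq> U then 1 else 0)" if U: "vec.subspace U"
  proof -
    have s: "sum F U = (\<Sum>v\<in>P \<inter> U - {0}. 1 / (real CARD('a) - 1))"
      by (rule sum.mono_neutral_cong_right) (auto simp: F_def)
    show ?thesis
    proof (cases "P \<subseteq> U")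
      case True
      then have "real (card (P \<inter> U - {0})) = real CARD('a) - 1"
        using card_subspace[OF P(1)] P vec.subspace_0[OF P(1)] q
        by (simp add: Int_absorb2 card_Diff_singleton of_nat_diff)
      then show ?thesis using True s q by simp
    next
      case False
      then show ?thesis using s dim_1_Int[OF P U] by simp
    qed
  qed
qed

text \<open>The vectors represented by some weight form a linear subspace containing every row,
  hence the whole row space.\<close>

lemma cameron_liebler_weight:
  fixes L :: "('a::{field,finite} ^ 'n) set set"
  assumes "cameron_liebler k L"
  shows "\<exists>F. point_weight F \<and> (\<forall>U\<in>kspaces k. sum F U = (if U \<in> L then 1 else 0))"
proof -
  \<comment> \<open>Only the coordinates at \<open>k\<close>-spaces are compared, so the padding
    columns do not matter.\<close>
  define Q :: "(real ^ (('a ^ 'n) set)) \<Rightarrow> bool" where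
    "Q = (\<lambda>x. \<exists>F. point_weight F \<and> (\<forall>U\<in>kspaces k. sum F U = x $ U))"
  have "Q (characteristic_vector L)"
  proof (rule span_induct)
    show "characteristic_vector L \<in> span (rows (incidence_matrix k))"
      using assms by (simp add: cameron_liebler_def)
    show "subspace {x. Q x}"
    proof (unfold subspace_def, intro conjI ballI allI)
      show "0 \<in> {x. Q x}" by (auto simp: Q_def point_weight_def intro!: exI[of _ "\<lambda>_. 0"])
    next
      fix x y assume "x \<in> {x. Q x}" "y \<in> {x. Q x}"
      then obtain F G where "point_weight F" "\<forall>U\<in>kspaces k. sum F U = x $ U"
        "point_weight G" "\<forall>U\<in>kspaces k. sum G U = y $ U" by (auto simp: Q_def)
      then show "x + y \<in> {x. Q x}"
        by (auto simp: Q_def point_weight_def sum.distrib intro!: exI[of _ "\<lambda>v. F v + G v"])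
    next
      fix c x assume "x \<in> {x. Q x}"
      then obtain F where "point_weight F" "\<forall>U\<in>kspaces k. sum F U = x $ U" by (auto simp: Q_def)
      then show "c *\<^sub>R x \<in> {x. Q x}"
        by (auto simp: Q_def point_weight_def sum_distrib_left[symmetric] intro!: exI[of _ "\<lambda>v. c * F v"])
    qed
  next
    fix x :: "real ^ (('a ^ 'n) set)" assume "x \<in> rows (incidence_matrix k)"
    then obtain P where x: "x = row P (incidence_matrix k)" by (auto simp: rows_def)
    show "Q x"
    proof (cases "P \<in> points")
      case True
      have "vec.subspace U" if "U \<in> kspaces k" for U :: "('a ^ 'n) set"
        using that by (simp add: kspaces_def)
      then show ?thesis
        unfolding Q_def using point_weight_of_point[OF True] True
        by (intro exI[of _ "\<lambda>v. if v \<in> P \<and> v \<noteq> 0 then 1 / (real CARD('a) - 1) else 0"])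
          (simp add: x row_def incidence_matrix_def)
    next
      \<comment> \<open>A row not belonging to a point is padding and is represented by the zero
        weight.\<close>
      case False
      then show ?thesis
        by (auto simp: Q_def point_weight_def x row_def incidence_matrix_def intro!: exI[of _ "\<lambda>_. 0"])
    qed
  qed
  then show ?thesis by (simp add: Q_def characteristic_vector_def)
qed

text \<open>Double counting of pairs of a \<open>k\<close>-space and a vector in it: all nonzero
  vectors lie in equally many \<open>k\<close>-spaces, and \<open>F 0 = 0\<close>. This identifies
  the parameter with the total weight.\<close>

lemma sum_point_weight_UNIV:
  fixes F :: "'a::{field,finite} ^ 'n \<Rightarrow> real"
  assumes "point_weight F" "\<forall>U\<in>kspaces k. sum F U = (if U \<in> L then 1 else 0)"
    and "L \<subseteq> kspaces k" "k \<le> CARD('n) - 1"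
  shows "real (card L) = sum F UNIV * gaussian_binomial CARD('a) (CARD('n) - 1) k"
proof -
  have "real (card L) = (\<Sum>U\<in>kspaces k. if U \<in> L then 1 else 0)"
    using assms(3) by (simp add: sum.If_cases Int_absorb1)
  also have "\<dots> = (\<Sum>U\<in>kspaces k. sum F U)" using assms(2) by simp
  also have "\<dots> = (\<Sum>U\<in>kspaces k. \<Sum>v\<in>UNIV. if v \<in> U then F v else 0)"
    by (rule sum.cong[OF refl]) (simp add: sum.If_cases)
  also have "\<dots> = (\<Sum>v\<in>UNIV. \<Sum>U\<in>kspaces k. if v \<in> U then F v else 0)" by (rule sum.swap)
  also have "\<dots> = (\<Sum>v\<in>UNIV. F v * real (card {U \<in> kspaces k. v \<in> U}))"
    by (intro sum.cong refl) (simp add: sum.If_cases Int_def)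
  also have "\<dots> = (\<Sum>v\<in>UNIV. F v * gaussian_binomial CARD('a) (CARD('n) - 1) k)"
  proof (rule sum.cong[OF refl])
    fix v :: "'a ^ 'n"
    show "F v * real (card {U \<in> kspaces k. v \<in> U}) =
        F v * gaussian_binomial CARD('a) (CARD('n) - 1) k"
      using card_kspaces_through[of v k] assms(1,4) by (cases "v = 0") (auto simp: point_weight_def)
  qed
  finally show ?thesis by (simp add: sum_distrib_right)
qed

section \<open>Weights of cosets and spans\<close>

lemma point_weight_zero: "point_weight F \<Longrightarrow> F 0 = 0"
  and point_weight_scale: "point_weight F \<Longrightarrow> c \<noteq> 0 \<Longrightarrow> F (c *s v) = F v"
  by (auto simp: point_weight_def)

lemma sum_over_span_insert:
  fixes X :: "('a::{field,finite} ^ 'n) set"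
  assumes "vec.subspace X" "p \<notin> X"
  shows "sum F (vec.span (insert p X)) = (\<Sum>c\<in>UNIV. \<Sum>x\<in>X. F (c *s p + x))"
  using sum.reindex_bij_betw[OF bij_betw_span_insert[OF assms], of F]
  by (simp add: sum.cartesian_product case_prod_unfold)

text \<open>Scaling by \<open>c \<noteq> 0\<close> maps \<open>p + X\<close> onto
  \<open>c *s p + X\<close> and preserves \<open>F\<close>, so the \<open>q - 1\<close> cosets other
  than \<open>X\<close> have equal sums.\<close>

lemma sum_point_weight_span_insert:
  fixes X :: "('a::{field,finite} ^ 'n) set" and F :: "'a ^ 'n \<Rightarrow> real"
  assumes "point_weight F" "vec.subspace X" "p \<notin> X"
  shows "sum F (vec.span (insert p X)) = sum F X + (real CARD('a) - 1) * (\<Sum>x\<in>X. F (p + x))"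
proof -
  have q: "CARD('a) \<ge> 2" by (rule two_le_card_field)
  have coset: "(\<Sum>x\<in>X. F (c *s p + x)) = (\<Sum>x\<in>X. F (p + x))" if c: "c \<noteq> 0" for c
  proof -
    have "bij_betw ((*s) c) X X"
      using c assms(2) by (intro bij_betwI[of _ _ _ "(*s) (inverse c)"]) (auto intro: vec.subspace_scale)
    then have "(\<Sum>x\<in>X. F (c *s p + x)) = (\<Sum>x\<in>X. F (c *s p + c *s x))"
      by (rule sum.reindex_bij_betw[symmetric])
    also have "\<dots> = (\<Sum>x\<in>X. F (p + x))"
      by (simp only: vec.scale_right_distrib[symmetric] point_weight_scale[OF assms(1) c])
    finally show ?thesis .
  qed
  have "sum F (vec.span (insert p X)) =
      (\<Sum>x\<in>X. F (0 *s p + x)) + (\<Sum>c\<in>UNIV - {0}. \<Sum>x\<in>X. F (c *s p + x))"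
    unfolding sum_over_span_insert[OF assms(2,3)] by (rule sum.remove) auto
  also have "(\<Sum>c\<in>UNIV - {0::'a}. \<Sum>x\<in>X. F (c *s p + x)) =
      (\<Sum>c\<in>UNIV - {0::'a}. \<Sum>x\<in>X. F (p + x))"
    by (rule sum.cong) (auto simp: coset)
  finally show ?thesis using q by (simp add: card_Diff_singleton of_nat_diff)
qed

lemma sum_point_weight_span_singleton:
  fixes v :: "'a::{field,finite} ^ 'n" and F :: "'a ^ 'n \<Rightarrow> real"
  assumes "point_weight F" "v \<noteq> 0"
  shows "sum F (vec.span {v}) = (real CARD('a) - 1) * F v"
  using sum_point_weight_span_insert[OF assms(1), of "{0}" v] assms
  by (simp add: point_weight_zero insert_commute[of v 0 "{}"])

section \<open>Information from subspaces disjoint from a given one\<close>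

text \<open>The images of one such \<open>V\<close> under \<open>flag_maps Z T\<close> are again
  admissible, and their nonzero vectors cover \<open>T - Z\<close> evenly.\<close>

lemma average_nonneg:
  fixes Z T :: "('a::{field,finite} ^ 'n) set" and F :: "'a ^ 'n \<Rightarrow> real"
  assumes "vec.subspace Z" "vec.subspace T" "Z \<subseteq> T" "F 0 = 0" "1 \<le> m" "vec.dim Z + m \<le> vec.dim T"
    and "\<And>V. vec.subspace V \<Longrightarrow> V \<subseteq> T \<Longrightarrow> V \<inter> Z = {0} \<Longrightarrow> vec.dim V = m \<Longrightarrow> 0 \<le> sum F V"
  shows "0 \<le> sum F (T - Z)"
proof -
  obtain V where V: "vec.subspace V" "V \<subseteq> T" "V \<inter> Z = {0}" "vec.dim V = m"
    using exists_disjoint_subspace[OF assms(1-3,6)] by auto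
  let ?A = "V - {0}"
  have "0 * real (card (T - Z)) \<le> real (card ?A) * sum F (T - Z)"
  proof (rule orbit_average_ge[OF assms(1,2)])
    show "?A \<subseteq> T - Z" using V by auto
    fix g assume g: "g \<in> flag_maps Z T"
    have "g ` V \<inter> Z = g ` (V \<inter> Z)"
      using flag_maps_image(1)[OF g] flag_maps_inj[OF g] by (metis image_Int)
    then have gZ: "g ` V \<inter> Z = {0}" using V(3) vec.linear_0[OF flag_maps_linear[OF g]] by simp
    have "0 \<le> sum F (g ` V)"
      using flag_maps_image_subspace[OF g V(1)] gZ V(4) image_mono[OF V(2), of g]
        flag_maps_image(2)[OF g]
      by (intro assms(7)) simp_all
    also have "sum F (g ` V) = sum F (g ` ?A)"
      using assms(4) vec.linear_0[OF flag_maps_linear[OF g]]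
      by (intro sum.mono_neutral_right) auto
    finally show "0 \<le> sum F (g ` ?A)" .
  qed
  moreover have "?A \<noteq> {}"
  proof
    assume "?A = {}"
    then have "vec.dim V \<le> vec.dim {0::'a ^ 'n}" by (intro vec.dim_subset) auto
    then show False using V(4) assms(5) by simp
  qed
  then have "card ?A > 0" using card_gt_0_iff finite by blast
  ultimately show ?thesis by (auto simp only: mult_zero_left zero_le_mult_iff of_nat_le_0_iff)
qed

lemma average_zero:
  fixes Z T :: "('a::{field,finite} ^ 'n) set" and F :: "'a ^ 'n \<Rightarrow> real"
  assumes "vec.subspace Z" "vec.subspace T" "Z \<subseteq> T" "F 0 = 0" "1 \<le> m" "vec.dim Z + m \<le> vec.dim T"
    and "\<And>V. vec.subspace V \<Longrightarrow> V \<subseteq> T \<Longrightarrow> V \<inter> Z = {0} \<Longrightarrow> vec.dim V = m \<Longrightarrow> sum F V = 0"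
  shows "sum F (T - Z) = 0"
proof (rule antisym)
  show "0 \<le> sum F (T - Z)" by (rule average_nonneg[of Z T F m, OF assms(1-6)]) (simp_all add: assms(7))
  have "0 \<le> (\<Sum>v\<in>T - Z. - F v)"
    by (rule average_nonneg[of Z T "\<lambda>v. - F v" m, OF assms(1-3) _ assms(5,6)]) (simp_all add: assms(4,7) sum_negf)
  then show "sum F (T - Z) \<le> 0" by (simp add: sum_negf)
qed

text \<open>
  To descend from dimension \<open>m + 1\<close> to \<open>m\<close>, put \<open>R = U + X\<close> and sum over all \<open>\<langle>p\<rangle> + X\<close> with
  \<open>p \<in> S - R\<close>. The result shows that \<open>(card S - card R) * f X\<close> is the same for all \<open>S\<close> with
  \<open>R \<subset> S \<subseteq> T\<close>, and there are two such \<open>S\<close> of different size, so the weight \<open>f X\<close> is \<open>0\<close>.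
\<close>

lemma zero_outside:
  fixes U T :: "('a::{field,finite} ^ 'n) set" and F :: "'a ^ 'n \<Rightarrow> real"
  assumes "1 \<le> m" "point_weight F" "vec.subspace U" "vec.subspace T" "U \<subseteq> T"
    and "vec.dim U + m < vec.dim T"
    and "\<And>V. vec.subspace V \<Longrightarrow> V \<subseteq> T \<Longrightarrow> V \<inter> U = {0} \<Longrightarrow> vec.dim V = m \<Longrightarrow> sum F V = 0"
    and "v \<in> T - U"
  shows "F v = 0"
  using assms(1,6,7)
proof (induction m rule: nat_induct_at_least)
  case base
  have v0: "v \<noteq> 0" using assms(8) vec.subspace_0[OF assms(3)] by auto
  have "\<not> vec.span {v} \<subseteq> U" using assms(8) by (simp add: span_subset_iff[OF assms(3)])
  then have "vec.span {v} \<inter> U = {0}" using v0 by (intro dim_1_Int assms(3)) auto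
  then have "sum F (vec.span {v}) = 0"
    using assms(8) v0 by (intro base.prems(2)) (simp_all add: span_subset_iff[OF assms(4)])
  then show ?case
    using sum_point_weight_span_singleton[OF assms(2) v0] two_le_card_field[where 'a='a] by simp
next
  case (Suc m)
  show ?case
  proof (rule Suc.IH)
    show "vec.dim U + m < vec.dim T" using Suc.prems(1) by simp
    fix X assume X: "vec.subspace X" "X \<subseteq> T" "X \<inter> U = {0}" "vec.dim X = m"
    define R where "R = vec.span (U \<union> X)"
    have R: "vec.subspace R" "R \<subseteq> T" "U \<subseteq> R" "X \<subseteq> R" "vec.dim R = vec.dim U + m"
      using dim_span_Un_disjoint[OF assms(3) X(1)] X assms(5)
      by (auto simp: R_def span_subset_iff[OF assms(4)] Int_commute intro: vec.span_base)
    have eq: "(real (card S) - real (card R)) * sum F X =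
          (real CARD('a) - 1) * real (card X) * sum F (R - U)"
      if S: "vec.subspace S" "R \<subseteq> S" "S \<subseteq> T" "vec.dim R < vec.dim S" for S
    proof -
      \<comment> \<open>Subspaces of \<open>S\<close> of vector dimension \<open>Suc m\<close>
        disjoint from \<open>U\<close> lie in \<open>T\<close> and have weight \<open>0\<close>;
        since \<open>vec.dim R < vec.dim S\<close>, there is room for one.\<close>
      have "sum F (S - U) = 0"
        using S R Suc.prems assms point_weight_zero[OF assms(2)]
        by (intro average_zero[of U S F "Suc m"]) auto
      moreover have "sum F (S - U) = sum F (S - R) + sum F (R - U)"
      proof -
        have "S - U = (S - R) \<union> (R - U)" using S R by auto
        then show ?thesis by (metis Diff_disjoint Int_Diff finite sum.union_disjoint inf_commute)
      qed
      ultimately have SR: "sum F (S - R) = - sum F (R - U)" by simp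
      \<comment> \<open>Each \<open>\<langle>p\<rangle> + X\<close> is disjoint from
        \<open>U\<close> because \<open>p\<close> avoids \<open>U + X\<close>.\<close>
      have "0 = (\<Sum>p\<in>S - R. sum F (vec.span (insert p X)))"
      proof (rule sum.neutral[symmetric], intro ballI)
        fix p assume p: "p \<in> S - R"
        show "sum F (vec.span (insert p X)) = 0"
        proof (rule Suc.prems(2))
          show "vec.span (insert p X) \<subseteq> T" using p S X by (auto simp: span_subset_iff[OF assms(4)])
          show "vec.span (insert p X) \<inter> U = {0}"
            using span_insert_Int[OF assms(3) X(1)] p X(3) by (simp add: R_def)
          show "vec.dim (vec.span (insert p X)) = Suc m"
            using dim_span_insert_subspace[OF X(1)] p R(4) X(4) by auto
        qed simp
      qed
      also have "\<dots> = (\<Sum>p\<in>S - R. sum F X + (real CARD('a) - 1) * (\<Sum>x\<in>X. F (p + x)))"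
        using R(4) by (intro sum.cong refl sum_point_weight_span_insert[OF assms(2) X(1)]) auto
      also have "\<dots> = real (card (S - R)) * sum F X +
          (real CARD('a) - 1) * (\<Sum>p\<in>S - R. \<Sum>x\<in>X. F (p + x))"
        by (simp add: sum.distrib sum_distrib_left)
      also have "(\<Sum>p\<in>S - R. \<Sum>x\<in>X. F (p + x)) = (\<Sum>x\<in>X. \<Sum>p\<in>S - R. F (p + x))"
        by (rule sum.swap)
      \<comment> \<open>Translation by a vector of \<open>X\<close>, which lies in \<open>R\<close>,
        permutes \<open>S - R\<close>.\<close>
      also have "\<dots> = (\<Sum>x\<in>X. sum F (S - R))"
      proof (rule sum.cong[OF refl])
        fix x assume x: "x \<in> X"
        then have xR: "x \<in> R" "x \<in> S" using R S by auto
        have "p + x \<in> R \<longleftrightarrow> p \<in> R" "p + x \<in> S \<longleftrightarrow> p \<in> S"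
          "p - x \<in> R \<longleftrightarrow> p \<in> R" "p - x \<in> S \<longleftrightarrow> p \<in> S" for p
          using xR R(1) S(1) vec.subspace_add vec.subspace_diff
          by (metis add_diff_cancel diff_add_cancel)+
        then have "bij_betw (\<lambda>p. p + x) (S - R) (S - R)"
          by (intro bij_betwI[of _ _ _ "\<lambda>p. p - x"]) auto
        then show "(\<Sum>p\<in>S - R. F (p + x)) = sum F (S - R)" by (rule sum.reindex_bij_betw)
      qed
      also have "real (card (S - R)) = real (card S) - real (card R)"
        using S(2) by (simp add: card_Diff_subset card_mono of_nat_diff)
      finally show ?thesis using SR by (simp add: algebra_simps)
    qed
    \<comment> \<open>As \<open>vec.dim R + 1 < vec.dim T\<close>, both
      \<open>\<langle>p\<rangle> + R\<close> and \<open>T\<close> are admissible in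
      \<open>eq\<close>, whose right-hand side is independent of the choice.\<close>
    have "\<not> T \<subseteq> R" using vec.dim_subset[of T R] R(5) Suc.prems(1) by auto
    then obtain p where p: "p \<in> T" "p \<notin> R" by blast
    define S where "S = vec.span (insert p R)"
    have S: "vec.subspace S" "R \<subseteq> S" "S \<subseteq> T" "vec.dim S = Suc (vec.dim R)"
      using dim_span_insert_subspace[OF R(1) p(2)] p(1) R(2)
      by (auto simp: S_def span_subset_iff[OF assms(4)] intro: vec.span_base)
    have "(real (card S) - real (card R)) * sum F X = (real (card T) - real (card R)) * sum F X"
      using eq[of S] eq[of T] S R Suc.prems(1) assms(4) by simp
    then have "real (card S) * sum F X = real (card T) * sum F X"
      by (simp add: left_diff_distrib)
    moreover have "card S < card T"
      using S(4) R(5) Suc.prems(1) two_le_card_field[where 'a='a]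
        power_strict_increasing[of "vec.dim S" "vec.dim T" "CARD('a)"]
      by (simp add: card_subspace S(1) assms(4) del: power_Suc)
    ultimately show "sum F X = 0" by simp
  qed
qed

section \<open>Two disjoint \<open>k\<close>-spaces\<close>

text \<open>For an isomorphism \<open>\<phi>\<close> from \<open>U\<close> to \<open>V\<close>, each
  graph of vectors \<open>u + g (\<phi> u)\<close> is a subspace of the same dimension as
  \<open>U\<close>, so its weight is nonnegative. As \<open>g\<close> varies,
  \<open>g (\<phi> u)\<close> runs evenly over the nonzero vectors of \<open>V\<close>.\<close>

lemma graph_pairs_nonneg:
  fixes U V :: "('a::{field,finite} ^ 'n) set" and F :: "'a ^ 'n \<Rightarrow> real"
  assumes "vec.subspace U" "vec.subspace V" "U \<inter> V = {0}" "vec.dim V = vec.dim U" "F 0 = 0"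
    and "U \<noteq> {0}"
    and "\<And>W. vec.subspace W \<Longrightarrow> vec.dim W = vec.dim U \<Longrightarrow> 0 \<le> sum F W"
  shows "0 \<le> (\<Sum>u\<in>U - {0}. \<Sum>y\<in>V - {0}. F (u + y))"
proof -
  let ?G = "flag_maps {0} V"
  obtain \<phi> where \<phi>: "Vector_Spaces.linear (*s) (*s) \<phi>" "\<phi> ` U = V" "inj_on \<phi> U"
    using vec.subspace_isomorphism[OF assms(1,2)] assms(4) by auto
  have \<phi>0: "\<phi> u \<in> V - {0}" if "u \<in> U - {0}" for u
    using \<phi> that vec.linear_0[OF \<phi>(1)] vec.subspace_0[OF assms(1)] by (auto simp: inj_on_def)
  have graph: "0 \<le> (\<Sum>u\<in>U - {0}. F (u + g (\<phi> u)))" if g: "g \<in> ?G" for g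
  proof -
    define h where "h = (\<lambda>u. u + g (\<phi> u))"
    have lin: "Vector_Spaces.linear (*s) (*s) h"
      unfolding h_def using Vector_Spaces.linear_compose[OF \<phi>(1) flag_maps_linear[OF g]]
      by (intro vec.linear_compose_add vec.linear_ident) (simp add: o_def)
    have gV: "g (\<phi> u) \<in> V" if "u \<in> U" for u
      using flag_maps_image(2)[OF g] \<phi>(2) that by blast
    have inj: "inj_on h U"
    proof (rule inj_onI)
      fix u w assume u: "u \<in> U" "w \<in> U" "h u = h w"
      then have "u - w = g (\<phi> w) - g (\<phi> u)" by (simp add: h_def algebra_simps)
      then have "u - w \<in> U \<inter> V"
        using u gV assms(1,2) by (metis IntI vec.subspace_diff)
      then show "u = w" using assms(3) by simp
    qed
    have "0 \<le> sum F (h ` U)"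
      using vec.linear_subspace_image[OF lin assms(1)] vec.dim_image_eq[OF lin, of U] inj
      by (intro assms(7)) (auto simp: span_subspace[OF assms(1)])
    also have "\<dots> = (\<Sum>u\<in>U. F (h u))" using inj by (simp add: sum.reindex)
    also have "\<dots> = (\<Sum>u\<in>U - {0}. F (h u))"
      using vec.linear_0[OF lin] assms(5) by (intro sum.mono_neutral_right) auto
    finally show ?thesis by (simp add: h_def)
  qed
  have "0 \<le> real (card (V - {0})) * (\<Sum>g\<in>?G. \<Sum>u\<in>U - {0}. F (u + g (\<phi> u)))"
    by (intro mult_nonneg_nonneg sum_nonneg graph) auto
  also have "\<dots> = (\<Sum>u\<in>U - {0}. real (card (V - {0})) * (\<Sum>g\<in>?G. F (u + g (\<phi> u))))"
    by (subst sum.swap) (simp add: sum_distrib_left)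
  also have "\<dots> = (\<Sum>u\<in>U - {0}. real (card ?G) * (\<Sum>y\<in>V - {0}. F (u + y)))"
    by (intro sum.cong refl sum_flag_maps[OF vec.subspace_single_0 assms(2) \<phi>0])
  also have "\<dots> = real (card ?G) * (\<Sum>u\<in>U - {0}. \<Sum>y\<in>V - {0}. F (u + y))"
    by (simp only: sum_distrib_left)
  finally show ?thesis
    using card_flag_maps_pos[of "{0}" V] by (simp add: zero_le_mult_iff card_gt_0_iff)
qed

lemma sum_over_span_Un:
  fixes U V :: "('a::{field,finite} ^ 'n) set" and F :: "'a ^ 'n \<Rightarrow> real"
  assumes "vec.subspace U" "vec.subspace V" "U \<inter> V = {0}"
  shows "sum F (vec.span (U \<union> V)) = (\<Sum>u\<in>U. \<Sum>y\<in>V. F (u + y))"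
proof -
  have "inj_on (\<lambda>(u, y). u + y) (U \<times> V)"
  proof (rule inj_onI, clarify)
    fix u y u' y' assume *: "u \<in> U" "y \<in> V" "u' \<in> U" "y' \<in> V" "u + y = u' + y'"
    then have eq: "u - u' = y' - y" by (simp add: algebra_simps)
    then have "u - u' \<in> U \<inter> V"
      using * assms(1,2) by (metis IntI vec.subspace_diff)
    then show "u = u' \<and> y = y'" using assms(3) eq by simp
  qed
  moreover have "(\<lambda>(u, y). u + y) ` (U \<times> V) = vec.span (U \<union> V)"
    by (auto simp: vec.span_Un span_subspace[OF assms(1)] span_subspace[OF assms(2)])
  ultimately show ?thesis
    using sum.reindex[of "\<lambda>(u, y). u + y" "U \<times> V" F]
    by (simp add: sum.cartesian_product case_prod_unfold)
qed

text \<open>With \<open>Z = U + V\<close>, the part of \<open>Z\<close> outside \<open>U\<close> and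
  \<open>V\<close> is nonnegative by graphs, and \<open>T - Z\<close> is nonnegative by averaging
  over \<open>k\<close>-spaces disjoint from \<open>Z\<close>. The latter exist because
  \<open>3 * k + 3 = (2 * k + 2) + (k + 1)\<close>.\<close>

lemma two_disjoint_spaces_sum:
  fixes U V T :: "('a::{field,finite} ^ 'n) set" and F :: "'a ^ 'n \<Rightarrow> real"
  assumes "F 0 = 0" "U \<in> kspaces k" "V \<in> kspaces k" "U \<inter> V = {0}"
    and "vec.subspace T" "U \<subseteq> T" "V \<subseteq> T" "3 * k + 3 \<le> vec.dim T"
    and nonneg: "\<And>W. W \<in> kspaces k \<Longrightarrow> 0 \<le> sum F W"
  shows "sum F U + sum F V \<le> sum F T"
proof -
  define Z where "Z = vec.span (U \<union> V)"
  have U: "vec.subspace U" "vec.dim U = k + 1" and V: "vec.subspace V" "vec.dim V = k + 1"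
    using assms by (auto simp: kspaces_def)
  have Z: "vec.subspace Z" "Z \<subseteq> T" "vec.dim Z = 2 * k + 2"
    using dim_span_Un_disjoint[OF U(1) V(1) assms(4)] assms(6,7) U V
    by (auto simp: Z_def span_subset_iff[OF assms(5)])
  have "0 \<le> sum F (T - Z)"
    using Z assms(8) by (intro average_nonneg[of Z T F "k + 1"] assms(1,5) nonneg) (auto simp: kspaces_def)
  moreover have "sum F T = sum F (T - Z) + sum F Z"
    using Z(2) by (intro sum.subset_diff) auto
  moreover have "sum F U + sum F V \<le> sum F Z"
  proof -
    have z: "0 \<in> U" "0 \<in> V" using vec.subspace_0 U V by auto
    have "U \<noteq> {0}" using U(2) by auto
    then have "0 \<le> (\<Sum>u\<in>U - {0}. \<Sum>y\<in>V - {0}. F (u + y))"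
      using U V assms(1,4) by (intro graph_pairs_nonneg nonneg) (auto simp: kspaces_def)
    moreover have "sum F Z = (\<Sum>y\<in>V. F y) + (\<Sum>u\<in>U - {0}. \<Sum>y\<in>V. F (u + y))"
      unfolding Z_def sum_over_span_Un[OF U(1) V(1) assms(4)]
      using z by (simp add: sum.remove[of U 0])
    moreover have "(\<Sum>u\<in>U - {0}. \<Sum>y\<in>V. F (u + y)) =
        (\<Sum>u\<in>U - {0}. F u) + (\<Sum>u\<in>U - {0}. \<Sum>y\<in>V - {0}. F (u + y))"
      using z by (simp add: sum.remove[of V 0] sum.distrib)
    moreover have "(\<Sum>u\<in>U - {0}. F u) = sum F U"
      using assms(1) by (intro sum.mono_neutral_left) auto
    ultimately show ?thesis by simp
  qed
  ultimately show ?thesis by simp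
qed

section \<open>Small weight on a subspace forces a point-pencil\<close>

lemma span_insert_eq_of_dim:
  fixes X Y :: "('a::field ^ 'n) set"
  assumes "vec.subspace Y" "vec.subspace X" "X \<subseteq> Y" "p \<in> Y" "p \<notin> X" "vec.dim Y = Suc (vec.dim X)"
  shows "vec.span (insert p X) = Y"
  using assms dim_span_insert_subspace[OF assms(2,5)]
  by (intro vec.subspace_dim_equal) (auto simp: span_subset_iff)

lemma coset_sums_eq_zero:
  fixes S S1 T :: "('a::{field,finite} ^ 'n) set" and F :: "'a ^ 'n \<Rightarrow> real"
  assumes T: "vec.subspace T" "Y \<subseteq> T"
    and S: "vec.subspace S" "y \<notin> S" "vec.span (insert y S) = Y"
    and S1: "vec.subspace S1" "z \<notin> S1" "vec.span (insert z S1) = Y"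
    and le: "\<And>v. v \<notin> T \<Longrightarrow> (\<Sum>s\<in>S. F (v + s)) \<le> 0"
    and ge: "\<And>v. v \<notin> T \<Longrightarrow> 0 \<le> (\<Sum>s\<in>S1. F (v + s))"
    and v: "v \<notin> T"
  shows "(\<Sum>s\<in>S. F (v + s)) = 0" "(\<Sum>s\<in>S1. F (v + s)) = 0"
proof -
  have yz: "y \<in> T" "z \<in> T" using S(3) S1(3) T(2) by (auto intro: vec.span_base)
  \<comment> \<open>Moving \<open>v\<close> by vectors of \<open>T\<close> keeps it outside
    \<open>T\<close>, so the sign hypotheses hold for every coset in both partitions of
    \<open>v + Y\<close>.\<close>
  have shift: "v + c *s p \<notin> T" if "p \<in> T" for c p
    using v that T(1) vec.subspace_diff vec.subspace_scale by (metis add_diff_cancel_right')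
  have 1: "(\<Sum>s\<in>Y. F (v + s)) = (\<Sum>c\<in>UNIV. \<Sum>s\<in>S. F ((v + c *s y) + s))"
    using sum_over_span_insert[OF S(1,2), of "\<lambda>s. F (v + s)"] by (simp only: S(3) add.assoc)
  have 2: "(\<Sum>s\<in>Y. F (v + s)) = (\<Sum>c\<in>UNIV. \<Sum>s\<in>S1. F ((v + c *s z) + s))"
    using sum_over_span_insert[OF S1(1,2), of "\<lambda>s. F (v + s)"] by (simp only: S1(3) add.assoc)
  have "(\<Sum>s\<in>Y. F (v + s)) \<le> 0" unfolding 1 by (intro sum_nonpos le shift yz)
  moreover have "0 \<le> (\<Sum>s\<in>Y. F (v + s))" unfolding 2 by (intro sum_nonneg ge shift yz)
  ultimately have Y0: "(\<Sum>s\<in>Y. F (v + s)) = 0" by simp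
  \<comment> \<open>Terms of one sign with total \<open>0\<close> all vanish; the coset wanted is
    the one with \<open>c = 0\<close>.\<close>
  have "\<forall>c\<in>UNIV. - (\<Sum>s\<in>S. F ((v + c *s y) + s)) = 0"
    using le shift yz Y0 1 by (intro sum_nonneg_eq_0_iff[THEN iffD1]) (auto simp: sum_negf)
  then have "(\<Sum>s\<in>S. F ((v + 0 *s y) + s)) = 0" by (metis UNIV_I neg_equal_0_iff_equal)
  then show "(\<Sum>s\<in>S. F (v + s)) = 0" by simp
  have "\<forall>c\<in>UNIV. (\<Sum>s\<in>S1. F ((v + c *s z) + s)) = 0"
    using ge shift yz Y0 2 by (intro sum_nonneg_eq_0_iff[THEN iffD1]) auto
  then have "(\<Sum>s\<in>S1. F ((v + 0 *s z) + s)) = 0" by (metis UNIV_I)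
  then show "(\<Sum>s\<in>S1. F (v + s)) = 0" by simp
qed

text \<open>A point of \<open>U\<close> is the intersection of \<open>U\<close> with a
  \<open>k\<close>-space \<open>W\<close> of \<open>T\<close>. As \<open>F\<close> vanishes on
  \<open>T - U\<close>, the point has the weight of \<open>W\<close>, which is \<open>0\<close> or
  \<open>1\<close>. Total weight \<open>1\<close> on \<open>U\<close> then leaves exactly one point
  of weight \<open>1\<close>.\<close>

lemma weight_of_point_on_subspace:
  fixes U T :: "('a::{field,finite} ^ 'n) set" and F :: "'a ^ 'n \<Rightarrow> real"
  assumes F: "point_weight F" and bin: "\<And>W. W \<in> kspaces k \<Longrightarrow> sum F W \<in> {0, 1}"
    and U: "U \<in> kspaces k" "sum F U = 1"
    and T: "vec.subspace T" "U \<subseteq> T" "2 * k + 1 \<le> vec.dim T"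
    and zero: "\<And>v. v \<in> T - U \<Longrightarrow> F v = 0"
  shows "\<exists>P\<in>points. P \<subseteq> T \<and>
    (\<forall>v\<in>T. F v = (if v \<in> P \<and> v \<noteq> 0 then 1 / (real CARD('a) - 1) else 0))"
proof -
  have q: "real CARD('a) > 1" using two_le_card_field[where 'a='a] by simp
  have sU: "vec.subspace U" "vec.dim U = k + 1" using U by (auto simp: kspaces_def)
  have point: "(real CARD('a) - 1) * F u \<in> {0, 1}" if u: "u \<in> U" "u \<noteq> 0" for u
  proof -
    have X: "vec.span {u} \<subseteq> U" "vec.dim (vec.span {u}) = 1"
      using u by (simp_all add: span_subset_iff[OF sU(1)])
    \<comment> \<open>The bound \<open>(k + 1) + k \<le> vec.dim T\<close> is what enlarging
      \<open>\<langle>u\<rangle>\<close> by \<open>k\<close> dimensions away from \<open>U\<close>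
      requires.\<close>
    have "vec.span (U \<union> vec.span {u}) = U" using X(1) span_subspace[OF sU(1)] by (simp add: Un_absorb2)
    then obtain W where W: "vec.subspace W" "vec.span {u} \<subseteq> W" "W \<subseteq> T" "W \<inter> U = vec.span {u} \<inter> U"
      "vec.dim W = k + 1"
      using extend_subspace_disjoint[OF sU(1) vec.subspace_span T(1,2), of "{u}" k] X T sU(2)
      by auto
    have "sum F W = sum F (W \<inter> U)"
      using W(3) zero by (intro sum.mono_neutral_right) auto
    also have "W \<inter> U = vec.span {u}" using W(4) X(1) by blast
    finally show ?thesis
      using bin[of W] W(1,5) sum_point_weight_span_singleton[OF F u(2)] by (simp add: kspaces_def)
  qed
  have nonneg: "0 \<le> F v" if "v \<in> U" for v
    using point[OF that] point_weight_zero[OF F] q mult_pos_neg[of "real CARD('a) - 1" "F v"]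
    by (cases "v = 0"; cases "F v < 0") auto
  obtain p where p: "p \<in> U" "F p \<noteq> 0" using U(2) by (metis sum.neutral zero_neq_one)
  then have p0: "p \<noteq> 0" using point_weight_zero[OF F] by auto
  have Fp: "(real CARD('a) - 1) * F p = 1" using point[OF p(1) p0] p(2) q by auto
  let ?P = "vec.span {p}"
  have PU: "?P \<subseteq> U" using p(1) by (simp add: span_subset_iff[OF sU(1)])
  have "sum F (U - ?P) = sum F U - sum F ?P" using PU by (simp add: sum_diff)
  then have "sum F (U - ?P) = 0"
    using sum_point_weight_span_singleton[OF F p0] Fp U(2) by simp
  then have UP: "F v = 0" if "v \<in> U - ?P" for v
    using that nonneg sum_nonneg_eq_0_iff[of "U - ?P" F] by auto
  have FP: "F v = 1 / (real CARD('a) - 1)" if v: "v \<in> ?P" "v \<noteq> 0" for v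
  proof -
    obtain c where "v = c *s p" using v(1) unfolding vec.span_singleton by blast
    then have "F v = F p" using v point_weight_scale[OF F] by auto
    then show ?thesis using Fp q by (simp add: field_simps)
  qed
  have "F v = (if v \<in> ?P \<and> v \<noteq> 0 then 1 / (real CARD('a) - 1) else 0)" if "v \<in> T" for v
  proof (cases "v \<in> U")
    case True
    then show ?thesis using FP UP point_weight_zero[OF F] by auto
  next
    case False
    then show ?thesis using zero[of v] that PU by auto
  qed
  moreover have "?P \<in> points" using p0 by (simp add: kspaces_def)
  moreover have "?P \<subseteq> T" using PU T(2) by blast
  ultimately show ?thesis by blast
qed

text \<open>The \<open>k\<close>-space \<open>\<langle>w\<rangle> + X\<close> has weight
  \<open>0\<close> or \<open>1\<close>, while \<open>X\<close> has weight \<open>1\<close> or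
  \<open>0\<close> according to whether it contains \<open>P\<close>; this gives the sign of the
  coset sum. Every \<open>S\<close> is then paired with an \<open>S1\<close> inside a common
  \<open>Y\<close> such that exactly one of the two contains \<open>P\<close>.\<close>

lemma coset_sum_zero:
  fixes P S T :: "('a::{field,finite} ^ 'n) set" and F :: "'a ^ 'n \<Rightarrow> real"
  assumes F: "point_weight F" and bin: "\<And>W. W \<in> kspaces k \<Longrightarrow> sum F W \<in> {0, 1}"
    and k: "1 \<le> k" and P: "P \<in> points" "P \<subseteq> T"
    and T: "vec.subspace T" "k < vec.dim T"
    and FT: "\<And>v. v \<in> T \<Longrightarrow> F v = (if v \<in> P \<and> v \<noteq> 0 then 1 / (real CARD('a) - 1) else 0)"
    and S: "vec.subspace S" "S \<subseteq> T" "vec.dim S = k" and v: "v \<notin> T"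
  shows "(\<Sum>s\<in>S. F (v + s)) = 0"
proof -
  have q: "real CARD('a) > 1" using two_le_card_field[where 'a='a] by simp
  have sP: "vec.subspace P" "vec.dim P = 1" using P by (auto simp: kspaces_def)
  obtain p where p: "p \<in> P" "p \<noteq> 0"
  proof -
    have "\<not> P \<subseteq> {0}" using vec.dim_subset[of P "{0}"] sP(2) by auto
    then show ?thesis using that by blast
  qed
  have PX: "P \<subseteq> X \<longleftrightarrow> p \<in> X" if X: "vec.subspace X" for X
    using dim_1_Int[OF sP X] p by blast
  have sum_sub: "sum F X = (if P \<subseteq> X then 1 else 0)" if X: "vec.subspace X" "X \<subseteq> T" for X
  proof -
    have "sum F X = (\<Sum>v\<in>X. if v \<in> P \<and> v \<noteq> 0 then 1 / (real CARD('a) - 1) else 0)"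
      using X(2) FT by (intro sum.cong refl) auto
    then show ?thesis using point_weight_of_point(2)[OF P(1) X(1)] by simp
  qed
  have coset: "(if P \<subseteq> X then 1 else 0) + (real CARD('a) - 1) * (\<Sum>s\<in>X. F (w + s)) \<in> {0, 1}"
    if X: "vec.subspace X" "X \<subseteq> T" "vec.dim X = k" and w: "w \<notin> T" for X w
  proof -
    have wX: "w \<notin> X" using X(2) w by blast
    have "sum F (vec.span (insert w X)) \<in> {0, 1}"
      using dim_span_insert_subspace[OF X(1) wX] X(3) by (intro bin) (simp add: kspaces_def)
    then show ?thesis
      by (simp only: sum_point_weight_span_insert[OF F X(1) wX] sum_sub[OF X(1,2)])
  qed
  have le: "(\<Sum>s\<in>X. F (w + s)) \<le> 0"
    if "vec.subspace X" "X \<subseteq> T" "vec.dim X = k" "p \<in> X" "w \<notin> T" for X w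
  proof -
    have "(real CARD('a) - 1) * (\<Sum>s\<in>X. F (w + s)) \<le> 0"
      using coset[OF that(1,2,3,5)] that(4) PX[OF that(1)] by auto
    then show ?thesis using q by (simp add: mult_le_0_iff)
  qed
  have ge: "0 \<le> (\<Sum>s\<in>X. F (w + s))"
    if "vec.subspace X" "X \<subseteq> T" "vec.dim X = k" "p \<notin> X" "w \<notin> T" for X w
  proof -
    have "0 \<le> (real CARD('a) - 1) * (\<Sum>s\<in>X. F (w + s))"
      using coset[OF that(1,2,3,5)] that(4) PX[OF that(1)] by auto
    then show ?thesis using q by (simp add: zero_le_mult_iff)
  qed
  have pT: "p \<in> T" using p P by blast
  show ?thesis
  proof (cases "p \<in> S")
    case True
    have PS: "P \<subseteq> S" using True PX[OF S(1)] by simp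
    \<comment> \<open>Here \<open>S1\<close> must avoid \<open>p\<close>: the point \<open>P\<close>
      of \<open>S\<close> is exchanged for a vector \<open>y\<close> outside \<open>S\<close>,
      keeping a complement \<open>S0\<close> of \<open>P\<close> in \<open>S\<close>.\<close>
    obtain S0 where S0: "vec.subspace S0" "S0 \<subseteq> S" "S0 \<inter> P = {0}" "vec.dim S0 = k - 1"
      using exists_disjoint_subspace[OF sP(1) S(1) PS, of "k - 1"] sP(2) S(3) k by auto
    have "\<not> T \<subseteq> S" using vec.dim_subset[of T S] T(2) S(3) by auto
    then obtain y where y: "y \<in> T" "y \<notin> S" by blast
    define S1 where "S1 = vec.span (insert y S0)"
    have yS0: "y \<notin> S0" using y S0(2) by blast
    have S1: "vec.subspace S1" "S1 \<subseteq> T" "vec.dim S1 = k"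
      using dim_span_insert_subspace[OF S0(1) yS0] y S0 S k
      by (auto simp: S1_def span_subset_iff[OF T(1)])
    have "vec.span (S \<union> S0) = S" using S0(2) span_subspace[OF S(1)] by (simp add: Un_absorb2)
    then have "S1 \<inter> S = S0 \<inter> S"
      using span_insert_Int[OF S(1) S0(1), of y] y(2) by (simp add: S1_def)
    then have pS1: "p \<notin> S1" using True S0(3) p by blast
    define Y where "Y = vec.span (insert y S)"
    have Y: "vec.subspace Y" "Y \<subseteq> T" "vec.dim Y = Suc k"
      using dim_span_insert_subspace[OF S(1) y(2)] y S
      by (auto simp: Y_def span_subset_iff[OF T(1)])
    have "S \<subseteq> Y" "y \<in> Y" by (auto simp: Y_def intro: vec.span_base)
    then have "S1 \<subseteq> Y" using S0(2) by (auto simp: S1_def span_subset_iff[OF Y(1)])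
    then have "vec.span (insert p S1) = Y"
      using Y S1 pS1 True \<open>S \<subseteq> Y\<close> by (intro span_insert_eq_of_dim) auto
    then show ?thesis
      by (intro coset_sums_eq_zero(1)[OF T(1) Y(2) S(1) y(2) Y_def[symmetric] S1(1) pS1 _ _ _ v])
        (auto intro!: le ge S S1 True pS1)
  next
    case False
    \<comment> \<open>Here \<open>S1\<close> must contain \<open>p\<close>, which is adjoined to a
      hyperplane \<open>S0\<close> of \<open>S\<close>; a vector \<open>y\<close> of
      \<open>S\<close> outside \<open>S0\<close> then completes \<open>S1\<close> to
      \<open>Y\<close>.\<close>
    obtain S0 where S0: "vec.subspace S0" "S0 \<subseteq> S" "vec.dim S0 = k - 1"
      using exists_superspace[OF vec.subspace_single_0 S(1), of "k - 1"] vec.subspace_0[OF S(1)] S(3) by auto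
    have "\<not> S \<subseteq> S0" using vec.dim_subset[of S S0] S(3) S0(3) k by auto
    then obtain y where y: "y \<in> S" "y \<notin> S0" by blast
    define S1 where "S1 = vec.span (insert p S0)"
    have pS0: "p \<notin> S0" using False S0(2) by blast
    have S1: "vec.subspace S1" "S1 \<subseteq> T" "vec.dim S1 = k" "p \<in> S1"
      using dim_span_insert_subspace[OF S0(1) pS0] pT S0 S k
      by (auto simp: S1_def span_subset_iff[OF T(1)] intro: vec.span_base)
    have "vec.span (S \<union> S0) = S" using S0(2) span_subspace[OF S(1)] by (simp add: Un_absorb2)
    then have "S1 \<inter> S = S0 \<inter> S"
      using span_insert_Int[OF S(1) S0(1), of p] False by (simp add: S1_def)
    then have yS1: "y \<notin> S1" using y by blast
    define Y where "Y = vec.span (insert p S)"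
    have Y: "vec.subspace Y" "Y \<subseteq> T" "vec.dim Y = Suc k"
      using dim_span_insert_subspace[OF S(1) False] pT S
      by (auto simp: Y_def span_subset_iff[OF T(1)])
    have "S \<subseteq> Y" "p \<in> Y" by (auto simp: Y_def intro: vec.span_base)
    then have "S1 \<subseteq> Y" using S0(2) by (auto simp: S1_def span_subset_iff[OF Y(1)])
    then have "vec.span (insert y S1) = Y"
      using Y S1 yS1 y(1) \<open>S \<subseteq> Y\<close> by (intro span_insert_eq_of_dim) auto
    then show ?thesis
      by (intro coset_sums_eq_zero(2)[OF T(1) Y(2) S1(1) yS1 _ S(1) False Y_def[symmetric] _ _ v])
        (auto intro!: le ge S S1 False)
  qed
qed

text \<open>The difference \<open>H\<close> of \<open>F\<close> and the weight of \<open>P\<close>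
  vanishes on \<open>T\<close>. It also vanishes on every \<open>k\<close>-space of
  \<open>\<langle>v\<rangle> + T\<close>, so \<open>zero_outside\<close> with the zero subspace
  gives \<open>H v = 0\<close>.\<close>

lemma pencil_if_vanishing:
  fixes U T :: "('a::{field,finite} ^ 'n) set" and F :: "'a ^ 'n \<Rightarrow> real"
  assumes F: "point_weight F" and bin: "\<And>W. W \<in> kspaces k \<Longrightarrow> sum F W \<in> {0, 1}"
    and k: "1 \<le> k" and U: "U \<in> kspaces k" "sum F U = 1"
    and T: "vec.subspace T" "U \<subseteq> T" "2 * k + 1 \<le> vec.dim T"
    and zero: "\<And>v. v \<in> T - U \<Longrightarrow> F v = 0"
  shows "\<exists>P\<in>points. \<forall>W\<in>kspaces k. sum F W = (if P \<subseteq> W then 1 else 0)"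
proof -
  obtain P where P: "P \<in> points" "P \<subseteq> T" and FT: "\<And>v. v \<in> T \<Longrightarrow>
      F v = (if v \<in> P \<and> v \<noteq> 0 then 1 / (real CARD('a) - 1) else 0)"
    using weight_of_point_on_subspace[OF F bin U T zero] by blast
  define E where "E = (\<lambda>v. if v \<in> P \<and> v \<noteq> 0 then 1 / (real CARD('a) - 1) else 0)"
  have E: "point_weight E" "\<And>W. vec.subspace W \<Longrightarrow> sum E W = (if P \<subseteq> W then 1 else 0)"
    unfolding E_def using point_weight_of_point[OF P(1)] by auto
  define H where "H = (\<lambda>v. F v - E v)"
  have H: "point_weight H" using F E(1) by (simp add: H_def point_weight_def)
  have HT: "H v = 0" if "v \<in> T" for v using FT[OF that] by (simp add: H_def E_def)
  have H0: "H v = 0" if v: "v \<notin> T" for v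
  proof -
    define T' where "T' = vec.span (insert v T)"
    have T': "vec.subspace T'" "T \<subseteq> T'" "v \<in> T'" "vec.dim T' = Suc (vec.dim T)"
      using dim_span_insert_subspace[OF T(1) v] by (auto simp: T'_def intro: vec.span_base)
    have "sum H W = 0" if W: "vec.subspace W" "W \<subseteq> T'" "vec.dim W = k + 1" for W
    proof (cases "W \<subseteq> T")
      case True
      then show ?thesis using HT by (intro sum.neutral) auto
    next
      case False
      then obtain w where w: "w \<in> W" "w \<notin> T" by blast
      define S where "S = W \<inter> T"
      have sS: "vec.subspace S" using W T by (simp add: S_def vec.subspace_inter)
      \<comment> \<open>Since \<open>T\<close> is a hyperplane of \<open>T'\<close>, a
        \<open>k\<close>-space of \<open>T'\<close> not inside \<open>T\<close> meets
        \<open>T\<close> in vector dimension exactly \<open>k\<close>.\<close>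
      have "vec.dim (vec.span (W \<union> T)) = Suc (vec.dim T)"
      proof (rule antisym)
        show "vec.dim (vec.span (W \<union> T)) \<le> Suc (vec.dim T)"
          using vec.dim_subset[of "vec.span (W \<union> T)" T'] W T' by (simp add: span_subset_iff)
        have "vec.span (insert w T) \<subseteq> vec.span (W \<union> T)" using w by (intro vec.span_mono) auto
        then show "Suc (vec.dim T) \<le> vec.dim (vec.span (W \<union> T))"
          using dim_span_insert_subspace[OF T(1) w(2)] vec.dim_subset by metis
      qed
      then have dS: "vec.dim S = k" using dim_span_Un[OF W(1) T(1)] W(3) by (simp add: S_def)
      have wS: "w \<notin> S" using w by (simp add: S_def)
      have eqW: "vec.span (insert w S) = W"
        using W sS w wS dS by (intro span_insert_eq_of_dim) (auto simp: S_def)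
      have "(\<Sum>s\<in>S. F (w + s)) = 0"
        using T(3) sS dS k by (intro coset_sum_zero[OF F bin k P T(1) _ FT _ _ _ w(2)]) (auto simp: S_def)
      then have "sum F W = sum F S"
        using sum_point_weight_span_insert[OF F sS wS] eqW by simp
      also have "\<dots> = sum E S"
        using FT by (intro sum.cong refl) (auto simp: S_def E_def)
      \<comment> \<open>As \<open>P\<close> lies in \<open>T\<close>, it is contained in
        \<open>W\<close> exactly when it is contained in \<open>W \<inter> T\<close>.\<close>
      also have "\<dots> = sum E W" using P(2) by (simp add: E(2) sS W(1)) (simp add: S_def)
      finally show ?thesis by (simp add: H_def sum_subtractf)
    qed
    moreover have "v \<in> T' - {0}" using T'(3) v vec.subspace_0[OF T(1)] by auto
    ultimately show "H v = 0"
      using T' T(3) vec.subspace_0[OF T'(1)]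
      by (intro zero_outside[of "k + 1" H "{0}" T'] H) auto
  qed
  have "H v = 0" for v using HT H0 by blast
  then have "F = E" by (auto simp: H_def fun_eq_iff)
  then show ?thesis using P(1) E(2) by (auto simp: kspaces_def)
qed

section \<open>The lower bound for the parameter\<close>

text \<open>A member of \<open>L\<close> in \<open>T\<close> disjoint from \<open>U\<close> would
  already give weight \<open>2\<close>. Without one, \<open>zero_outside\<close> and
  \<open>pencil_if_vanishing\<close> make \<open>L\<close> a point-pencil.\<close>

lemma weight_ge_two:
  fixes L :: "('a::{field,finite} ^ 'n) set set" and F :: "'a ^ 'n \<Rightarrow> real"
  assumes F: "point_weight F" and FL: "\<forall>U\<in>kspaces k. sum F U = (if U \<in> L then 1 else 0)"
    and L: "L \<subseteq> kspaces k" "\<not> (\<exists>P\<in>points. L = point_pencil k P)" and k: "1 \<le> k"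
    and U: "U \<in> L" and T: "vec.subspace T" "U \<subseteq> T" "vec.dim T = 3 * k + 3"
  shows "2 \<le> sum F T"
proof (rule ccontr)
  assume lt: "\<not> 2 \<le> sum F T"
  have bin: "sum F W \<in> {0, 1}" "0 \<le> sum F W" if "W \<in> kspaces k" for W
    using FL that by auto
  have kU: "U \<in> kspaces k" using U L(1) by blast
  have sU: "vec.subspace U" "vec.dim U = k + 1" using kU by (auto simp: kspaces_def)
  have fU: "sum F U = 1" using FL kU U by simp
  have "F v = 0" if v: "v \<in> T - U" for v
  proof (rule zero_outside[OF _ F sU(1) T(1,2) _ _ v])
    fix V assume V: "vec.subspace V" "V \<subseteq> T" "V \<inter> U = {0}" "vec.dim V = k + 1"
    then have kV: "V \<in> kspaces k" by (simp add: kspaces_def)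
    have "sum F U + sum F V \<le> sum F T"
      using V(3) T by (intro two_disjoint_spaces_sum[of F U k V T, OF point_weight_zero[OF F] kU kV] V(2) bin(2))
        (auto simp: Int_commute)
    then show "sum F V = 0" using bin[OF kV] fU lt by auto
  qed (use T(3) sU(2) in auto)
  then obtain P where P: "P \<in> points" "\<forall>W\<in>kspaces k. sum F W = (if P \<subseteq> W then 1 else 0)"
    using pencil_if_vanishing[OF F bin(1) k kU fU T(1,2)] T(3) by auto
  have "L = point_pencil k P"
    using L(1) FL P(2) by (fastforce simp: point_pencil_def split: if_splits)
  then show False using L(2) P(1) by blast
qed

lemma card_diff_subspaces:
  fixes U T :: "('a::{field,finite} ^ 'n) set"
  assumes "vec.subspace U" "vec.subspace T" "U \<subseteq> T"
  shows "real (card (T - U)) = real CARD('a) ^ vec.dim T - real CARD('a) ^ vec.dim U"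
  using assms by (simp add: card_Diff_subset of_nat_diff card_mono flip: card_subspace of_nat_power)

theorem theorem6p2:
  fixes L :: "('a::{field,finite} ^ 'n) set set"
    and n k q :: nat and x :: real
  assumes "CARD('a) = q"
    and "CARD('n) = n + 1"
    and "n \<ge> 3 * k + 3" and "k \<ge> 1"
    and "cameron_liebler k L"
    and "has_parameter k L x"
    and "\<not> (\<exists>P \<in> points. L = point_pencil k P)"
    and "L \<noteq> {}"
  shows "x \<ge> (real q ^ (n - k) - 1) / (real q ^ (2 * k + 2) - 1) + 1"
proof -
  have q1: "real q > 1" using two_le_card_field[where 'a='a] assms(1) by simp
  have LK: "L \<subseteq> kspaces k" using assms(5) by (simp add: cameron_liebler_def)
  obtain F :: "'a ^ 'n \<Rightarrow> real" where F: "point_weight F"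
    and FL: "\<forall>U\<in>kspaces k. sum F U = (if U \<in> L then 1 else 0)"
    using cameron_liebler_weight[OF assms(5)] by blast
  have "gaussian_binomial q n k > 0"
    unfolding gaussian_binomial_def
    using q1 assms(3) by (intro divide_pos_pos prod_pos ballI) (auto simp: one_less_power)
  then have x: "x = sum F UNIV"
    using sum_point_weight_UNIV[OF F FL LK] assms(1-3,6) by (simp add: has_parameter_def)
  obtain U where U: "U \<in> L" using assms(8) by blast
  have kU: "U \<in> kspaces k" using U LK by blast
  then have sU: "vec.subspace U" "vec.dim U = k + 1" by (auto simp: kspaces_def)
  have fU: "sum F U = 1" using FL kU U by simp
  have dUNIV: "vec.dim (UNIV :: ('a ^ 'n) set) = n + 1"
    using vec_dim_card[where 'a='a and 'n='n] assms(2) by simp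
  obtain T where T: "vec.subspace T" "U \<subseteq> T" "vec.dim T = 3 * k + 3"
    using exists_superspace[OF sU(1) vec.subspace_UNIV, of "3 * k + 3"] dUNIV sU(2) assms(3) by auto
  \<comment> \<open>Every image of \<open>T\<close> is again a space of vector dimension
    \<open>3 * k + 3\<close> through \<open>U\<close>, of weight at least \<open>2\<close>; removing
    \<open>U\<close>, of weight \<open>1\<close>, leaves at least \<open>1\<close>.\<close>
  have "1 * real (card (UNIV - U)) \<le> real (card (T - U)) * sum F (UNIV - U)"
  proof (rule orbit_average_ge[OF sU(1) vec.subspace_UNIV])
    fix g assume g: "g \<in> flag_maps U UNIV"
    have UT: "U \<subseteq> g ` T" using flag_maps_image(1)[OF g] T(2) by blast
    have "g ` (T - U) = g ` T - U"
      using flag_maps_image(1)[OF g] flag_maps_inj[OF g] by (simp add: image_set_diff)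
    then have "sum F (g ` (T - U)) = sum F (g ` T) - 1" using UT fU by (simp add: sum_diff)
    moreover have "2 \<le> sum F (g ` T)"
      using flag_maps_image_subspace[OF g T(1)] UT T(3)
      by (intro weight_ge_two[OF F FL LK assms(7,4) U]) auto
    ultimately show "1 \<le> sum F (g ` (T - U))" by simp
  qed auto
  moreover have "sum F (UNIV - U) = x - 1" using fU by (simp add: x sum_diff)
  moreover have "real (card (UNIV - U)) = real q ^ (k + 1) * (real q ^ (n - k) - 1)"
  proof -
    have "real (card (UNIV - U)) = real q ^ (n + 1) - real q ^ (k + 1)"
      using card_diff_subspaces[OF sU(1) vec.subspace_UNIV] dUNIV sU(2) assms(1) by simp
    moreover have "real q ^ (n + 1) = real q ^ (k + 1) * real q ^ (n - k)"
      using assms(3) by (simp flip: power_add power_Suc)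
    ultimately show ?thesis by (simp only: right_diff_distrib mult_1_right)
  qed
  moreover have "real (card (T - U)) = real q ^ (k + 1) * (real q ^ (2 * k + 2) - 1)"
  proof -
    have "real (card (T - U)) = real q ^ (3 * k + 3) - real q ^ (k + 1)"
      using card_diff_subspaces[OF sU(1) T(1,2)] T(3) sU(2) assms(1) by simp
    moreover have "3 * k + 3 = (k + 1) + (2 * k + 2)" by simp
    then have "real q ^ (3 * k + 3) = real q ^ (k + 1) * real q ^ (2 * k + 2)"
      by (simp only: power_add)
    ultimately show ?thesis by (simp only: right_diff_distrib mult_1_right)
  qed
  \<comment> \<open>Both cardinalities carry the factor \<open>q ^ (k + 1)\<close> from
    \<open>U\<close>; cancelling it leaves the exponents \<open>n - k\<close> and
    \<open>2 * k + 2\<close>.\<close>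
  ultimately have "real q ^ (k + 1) * (real q ^ (n - k) - 1) \<le>
      real q ^ (k + 1) * ((real q ^ (2 * k + 2) - 1) * (x - 1))"
    by (simp only: mult_1 mult.assoc)
  then have "real q ^ (n - k) - 1 \<le> (real q ^ (2 * k + 2) - 1) * (x - 1)"
    using q1 by (simp only: mult_le_cancel_left_pos zero_less_power)
  moreover have "real q ^ (2 * k + 2) - 1 > 0" using one_less_power[OF q1, of "2 * k + 2"] by simp
  ultimately have "(real q ^ (n - k) - 1) / (real q ^ (2 * k + 2) - 1) \<le> x - 1"
    by (simp only: pos_divide_le_eq mult.commute)
  then show ?thesis by simp
qed

end
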